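(* For all integers $a,r\ge 2$, $$\mathrm{ex}_{\Pi}\left(2r,\ a\binom{2r}{2}+\mathrm{ex}(2r,K_{r+1})-1\right)=a^{\frac{1-x_{\star}(r,1)}{r-1}}\,(a+1)^{\frac{r-2+x_{\star}(r,1)}{r-1}},$$ where $$x_{\star}(r,1):=\frac{\log\left(\frac{a+1}{a}\right)}{\log\left(\frac{(a+1)^r}{(a-1)^{r-1}a}\right)}.$$
   Context: A multigraph is a pair $G=(V,w)$ with $V$ a finite set and $w:V^{(2)}\to\mathbb{Z}_{\ge 0}$, where $V^{(2)}$ is the set of 2-element subsets of $V$; $w(uv)$ is the multiplicity of the pair $uv$. For integers $s\ge 2$, $q\ge 0$, $G$ is an $(s,q)$-graph if $\sum_{xy\in X^{(2)}}w(xy)\le q$ for every $s$-element subset $X\subseteq V$. $\mathcal{F}(n,s,q)$ is the set of all $(s,q)$-graphs on vertex set $[n]=\{1,\dots,n\}$. $P(G):=\prod_{uv\in V^{(2)}}w(uv)$. Set $\mathrm{ex}_{\Pi}(n,s,q):=\max\{P(G):G\in\mathcal{F}(n,s,q)\}$ and $\mathrm{ex}_{\Pi}(s,q):=\lim_{n\to\infty}\left(\mathrm{ex}_{\Pi}(n,s,q)\right)^{1/\binom n2}$. The Turán number $\mathrm{ex}(n,K_{r+1})$ is the maximum number of edges in a $K_{r+1}$-free (ordinary, simple) graph on $n$ vertices. *)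

theory Defs
  imports Complex_Main "HOL-Library.Ramsey"
begin

text \<open>
  A multigraph on a vertex set is given by its multiplicity function on the set \<open>[V]\<^bsup>2\<^esup>\<close> of
  2-element subsets. The extensional function space makes this function unique: it carries no
  information outside \<open>[V]\<^bsup>2\<^esup>\<close>.
\<close>

definition multigraph :: "'a set \<Rightarrow> ('a set \<Rightarrow> nat) \<Rightarrow> bool" where
  "multigraph V w \<longleftrightarrow> finite V \<and> w \<in> [V]\<^bsup>2\<^esup> \<rightarrow>\<^sub>E UNIV"

definition sq_graph :: "nat \<Rightarrow> nat \<Rightarrow> 'a set \<Rightarrow> ('a set \<Rightarrow> nat) \<Rightarrow> bool" where
  "sq_graph s q V w \<longleftrightarrow> multigraph V w \<and> (\<forall>X \<in> [V]\<^bsup>s\<^esup>. (\<Sum>e \<in> [X]\<^bsup>2\<^esup>. w e) \<le> q)"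

definition sq_graphs :: "nat \<Rightarrow> nat \<Rightarrow> nat \<Rightarrow> (nat set \<Rightarrow> nat) set" where
  "sq_graphs n s q = {w. sq_graph s q {1..n} w}"

definition edge_product :: "'a set \<Rightarrow> ('a set \<Rightarrow> nat) \<Rightarrow> nat" where
  "edge_product V w = (\<Prod>e \<in> [V]\<^bsup>2\<^esup>. w e)"

text \<open>
  For \<open>2 \<le> s \<le> n\<close> every multiplicity is at most \<open>q\<close>, so the maximum is over a finite nonempty set.
  If \<open>2 \<le> n < s\<close> the \<open>(s,q)\<close> condition is void, no maximum exists and the value is unspecified;
  for fixed \<open>s\<close> this concerns only finitely many \<open>n\<close> and does not affect the limit.
\<close>

definition ex_prod_fin :: "nat \<Rightarrow> nat \<Rightarrow> nat \<Rightarrow> nat" where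
  "ex_prod_fin n s q = Max (edge_product {1..n} ` sq_graphs n s q)"

definition ex_prod_seq :: "nat \<Rightarrow> nat \<Rightarrow> nat \<Rightarrow> real" where
  "ex_prod_seq s q n = root (n choose 2) (real (ex_prod_fin n s q))"

definition ex_prod :: "nat \<Rightarrow> nat \<Rightarrow> real" where
  "ex_prod s q = lim (ex_prod_seq s q)"

text \<open>\<open>turan_number n k\<close> is \<open>ex(n, K\<^sub>k)\<close>, the simple graph being given by its edge set on \<open>{1..n}\<close>.\<close>

definition turan_number :: "nat \<Rightarrow> nat \<Rightarrow> nat" where
  "turan_number n k = Max (card ` {E. E \<subseteq> [{1..n}]\<^bsup>2\<^esup> \<and> \<not> (\<exists>K \<in> [{1..n}]\<^bsup>k\<^esup>. clique K E)})"

text \<open>The quantity \<open>x\<^sub>\<star>(r,1)\<close>; its dependence on \<open>a\<close> is made explicit.\<close>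

definition x_star_1 :: "nat \<Rightarrow> nat \<Rightarrow> real" where
  "x_star_1 a r =
     ln ((real a + 1) / real a) / ln ((real a + 1) ^ r / ((real a - 1) ^ (r - 1) * real a))"

end

theory Submission
  imports Defs "HOL-Real_Asymp.Real_Asymp"
begin

text \<open>
  Since \<open>ex(2r, K\<^bsub>r+1\<^esub>)\<close> is the number of pairs in a \<open>2r\<close>-set minus \<open>r\<close>, the bound on the
  weight of \<open>2r\<close>-sets becomes transparent in terms of the defect \<open>a + 1 - w(e)\<close>: every
  \<open>2r\<close>-set must have total defect at least \<open>r + 1\<close>, one more than it may have when the
  multiplicities are \<open>a\<close> inside and \<open>a + 1\<close> across the parts of an \<open>r\<close>-partition. On the
  logarithmic scale a pair of defect 1 costs \<open>B = ln ((a + 1) / a)\<close> and a pair of defect 2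
  costs \<open>A = ln ((a + 1) / (a - 1))\<close>.

  The extremal pattern lowers one part further: \<open>r\<close> parts, multiplicity \<open>a + 1\<close> across,
  \<open>a - 1\<close> inside one special part and \<open>a\<close> inside the others. The proportions \<open>x\<close> of the special
  part and \<open>y\<close> of each other part that minimise the total cost satisfy \<open>x A = y B\<close>, so all
  vertices lose the same amount, and the density is \<open>exp (ln (a + 1) - y B)\<close>. This is the lower
  bound (\<open>blowup_sparse\<close>, \<open>ln_ex_prod_fin_ge\<close>).

  For the upper bound it suffices to find, in every large graph with positive multiplicities, a
  vertex whose product degree is asymptotically at most that of the pattern
  (\<open>exists_low_degree_vertex\<close>); deleting such vertices one at a time bounds the product
  (\<open>ln_product_le\<close>). If there is no such vertex, then averaging over any probability
  weight \<open>p\<close> on a bounded set \<open>X\<close> of vertices yields a new vertex \<open>u\<close> whose \<open>p\<close>-average cost to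
  \<open>X\<close> is below \<open>y B\<close>. Finitely many well chosen applications of this principle
  are contradictory:

  \<^item> With uniform weights, sets grow one vertex at a time while their defect stays small. A set
    of at most \<open>2r\<close> vertices with smaller defect than a set of that size can have in the pattern
    would grow to a \<open>2r\<close>-set of defect at most \<open>r\<close>. So every such set satisfies a lower bound on
    its defect, and the growth produces sets attaining it.
  \<^item> A set of \<open>2r - 1\<close> vertices attaining the bound must be a perfect matching of defect 1
    pairs on all but one of its vertices. Weight \<open>x\<close> on the isolated vertex and \<open>y / 2\<close> on the others
    yields a path on four vertices plus a matching.
  \<^item> Weight \<open>(x + y) / 4\<close> on the path and \<open>y / 2\<close> on the matching closes the path to a 5-cycle.
  \<^item> Weight \<open>(x + y) / 5\<close> on the 5-cycle and \<open>y / 2\<close> on the matching admits no new vertex.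

  In these steps the costs of the new vertices are compared with \<open>y B\<close> by means of \<open>y < 3 x\<close>,
  that is \<open>A < 3 B\<close>, which holds for all \<open>a \<ge> 2\<close>.
\<close>

section \<open>Pairs and sums over pairs\<close>

lemma real_choose_two: "real (n choose 2) = real n * (real n - 1) / 2"
  by (cases n) (simp_all add: choose_two field_char_0_class.of_nat_div mod_eq_0_iff_dvd algebra_simps)

lemma root_exp: "0 < k \<Longrightarrow> root k (exp u) = exp (u / real k)"
proof -
  assume k: "0 < k"
  have "exp u = exp (u / real k) ^ k" using k by (simp flip: exp_of_nat_mult)
  then show ?thesis using k by (simp add: real_root_power_cancel)
qed

lemma choose_two_le: "real (n choose 2) \<le> (real n)\<^sup>2 / 2"
  by (simp add: real_choose_two power2_eq_square algebra_simps)

lemma nsets_2_insert: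
  assumes "u \<notin> X"
  shows "[insert u X]\<^bsup>2\<^esup> = [X]\<^bsup>2\<^esup> \<union> (\<lambda>v. {u, v}) ` X"
proof (intro set_eqI iffI)
  fix e assume "e \<in> [insert u X]\<^bsup>2\<^esup>"
  then obtain v w where "e = {v, w}" "v \<noteq> w" "v \<in> insert u X" "w \<in> insert u X"
    by (auto simp: nsets_def card_2_iff)
  then show "e \<in> [X]\<^bsup>2\<^esup> \<union> (\<lambda>v. {u, v}) ` X"
    by (auto simp: nsets_def insert_commute)
next
  fix e assume "e \<in> [X]\<^bsup>2\<^esup> \<union> (\<lambda>v. {u, v}) ` X"
  then show "e \<in> [insert u X]\<^bsup>2\<^esup>"
    using assms by (auto simp: nsets_def card_insert_if)
qed

lemma finite_nsets_2 [simp]: "finite X \<Longrightarrow> finite ([X]\<^bsup>2\<^esup>)"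
  by (simp add: finite_imp_finite_nsets)

lemma sum_nsets_2_insert:
  fixes f :: "'a set \<Rightarrow> 'b::comm_monoid_add"
  assumes "finite X" "u \<notin> X"
  shows "(\<Sum>e\<in>[insert u X]\<^bsup>2\<^esup>. f e) = (\<Sum>e\<in>[X]\<^bsup>2\<^esup>. f e) + (\<Sum>v\<in>X. f {u, v})"
proof -
  have "[X]\<^bsup>2\<^esup> \<inter> (\<lambda>v. {u, v}) ` X = {}"
    using assms by (auto simp: nsets_def)
  moreover have "inj_on (\<lambda>v. {u, v}) X"
    using assms by (auto simp: inj_on_def doubleton_eq_iff)
  ultimately show ?thesis
    using assms by (simp add: nsets_2_insert sum.union_disjoint sum.reindex)
qed

lemma sum_eq_one_int:
  fixes f :: "'a \<Rightarrow> int"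
  assumes "finite M" "\<And>v. v \<in> M \<Longrightarrow> 0 \<le> f v" "sum f M = 1"
  obtains m where "m \<in> M" "f m = 1" "\<And>v. v \<in> M \<Longrightarrow> v \<noteq> m \<Longrightarrow> f v = 0"
proof -
  obtain m where m: "m \<in> M" "f m \<noteq> 0"
    using assms(3) by (metis sum.neutral zero_neq_one)
  have s: "sum f M = f m + sum f (M - {m})"
    using assms(1) m by (simp add: sum.remove)
  have n: "0 \<le> sum f (M - {m})"
    using assms by (intro sum_nonneg) auto
  have fm: "f m = 1" "sum f (M - {m}) = 0"
    using s n m assms by (smt (verit))+
  then have "\<forall>v\<in>M - {m}. f v = 0"
    using assms by (subst (asm) sum_nonneg_eq_0_iff) auto
  then show thesis using that m fm by auto
qed

section \<open>The Turan number of \<open>K\<^bsub>r+1\<^esub>\<close> on \<open>2r\<close> vertices\<close>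

text \<open>
  Deleting one end of each missing edge leaves a clique.
\<close>

lemma clique_if_few_missing_edges:
  assumes "finite V" "E \<subseteq> [V]\<^bsup>2\<^esup>" "card ([V]\<^bsup>2\<^esup> - E) + k \<le> card V"
  shows "\<exists>K\<in>[V]\<^bsup>k\<^esup>. clique K E"
proof -
  define N where "N = [V]\<^bsup>2\<^esup> - E"
  \<comment> \<open>an arbitrary end of each missing edge\<close>
  define f :: "'a set \<Rightarrow> 'a" where "f e = (SOME v. v \<in> e)" for e
  have fin: "finite N" using assms by (simp add: N_def)
  have "card V - card (f ` N) \<le> card (V - f ` N)"
    using fin by (intro diff_card_le_card_Diff) auto
  then have "k \<le> card (V - f ` N)"
    using assms(3) card_image_le[OF fin, of f] unfolding N_def[symmetric] by linarith
  then obtain K where K: "K \<subseteq> V - f ` N" "card K = k" "finite K"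
    by (rule obtain_subset_with_card_n)
  have "{v, w} \<in> E" if "v \<in> K" "w \<in> K" "v \<noteq> w" for v w
  proof (rule ccontr)
    assume "{v, w} \<notin> E"
    then have "{v, w} \<in> N" using that K by (auto simp: N_def nsets_def card_insert_if)
    then have "f {v, w} \<in> f ` N" by (rule imageI)
    moreover have "f {v, w} \<in> {v, w}" unfolding f_def by (rule someI) auto
    then have "f {v, w} \<in> K" using that(1,2) by auto
    ultimately show False using K(1) by auto
  qed
  then show ?thesis using K by (intro bexI[of _ K]) (auto simp: clique_def nsets_def)
qed

text \<open>
  Fewer than \<open>r\<close> missing edges leave a clique on \<open>r + 1\<close> vertices; conversely, removing the
  perfect matching of the pairs \<open>{2i - 1, 2i}\<close> destroys all such cliques by the pigeonhole principle.
\<close>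

lemma turan_number_double:
  assumes "1 \<le> r"
  shows "turan_number (2 * r) (r + 1) = (2 * r choose 2) - r"
proof -
  let ?V = "{1..2 * r}"
  define S where "S = {E. E \<subseteq> [?V]\<^bsup>2\<^esup> \<and> \<not> (\<exists>K\<in>[?V]\<^bsup>(r + 1)\<^esup>. clique K E)}"
  have fin: "finite S" unfolding S_def by (rule finite_subset[of _ "Pow ([?V]\<^bsup>2\<^esup>)"]) auto
  have upper: "card E \<le> (2 * r choose 2) - r" if "E \<in> S" for E
  proof -
    have E: "E \<subseteq> [?V]\<^bsup>2\<^esup>" using that S_def by auto
    have "r \<le> card ([?V]\<^bsup>2\<^esup> - E)"
      using clique_if_few_missing_edges[of ?V E "r + 1"] that E unfolding S_def by fastforce
    then have "r \<le> (2 * r choose 2) - card E" using E by (simp add: card_Diff_subset finite_subset)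
    then show ?thesis using assms by linarith
  qed
  define M where "M = (\<lambda>i. {2 * i - 1, 2 * i}) ` {1..r}"
  have M: "M \<subseteq> [?V]\<^bsup>2\<^esup>" unfolding M_def by (auto simp: nsets_def card_insert_if)
  have "inj_on (\<lambda>i. {2 * i - 1, 2 * i}) {1..r}"
    by (auto simp: inj_on_def doubleton_eq_iff)
  then have cM: "card M = r" unfolding M_def by (simp add: card_image)
  have "[?V]\<^bsup>2\<^esup> - M \<in> S"
  proof -
    have "\<not> clique K ([?V]\<^bsup>2\<^esup> - M)" if K: "K \<in> [?V]\<^bsup>(r + 1)\<^esup>" for K
    proof
      assume cl: "clique K ([?V]\<^bsup>2\<^esup> - M)"
      let ?h = "\<lambda>v :: nat. (v + 1) div 2"
      have "?h ` K \<subseteq> {1..r}" 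
      proof (rule image_subsetI)
        fix v assume "v \<in> K"
        then have "1 \<le> v \<and> v \<le> 2 * r" using K by (auto simp: nsets_def)
        then have "1 \<le> ?h v \<and> ?h v \<le> r" by linarith
        then show "?h v \<in> {1..r}" by simp
      qed
      then have "card (?h ` K) \<le> r" using card_mono[of "{1..r}" "?h ` K"] by simp
      then have "\<not> inj_on ?h K" using K by (auto simp: nsets_def dest: card_image)
      then obtain v w where vw: "v \<in> K" "w \<in> K" "?h v = ?h w" "v < w"
        unfolding inj_on_def by (metis linorder_neq_iff)
      define i where "i = ?h v"
      have eq: "v = 2 * i - 1" "w = 2 * i" using vw unfolding i_def by linarith+
      have "i \<in> {1..r}" using vw \<open>?h ` K \<subseteq> {1..r}\<close> unfolding i_def by blast
      then have "{2 * i - 1, 2 * i} \<in> M" unfolding M_def by blast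
      then have "{v, w} \<in> M" by (simp only: eq)
      moreover have "v \<noteq> w" using vw by simp
      then have "{v, w} \<in> [?V]\<^bsup>2\<^esup> - M" using cl vw(1,2) unfolding clique_def by blast
      ultimately show False by simp
    qed
    then show ?thesis unfolding S_def by blast
  qed
  moreover have "card ([?V]\<^bsup>2\<^esup> - M) = (2 * r choose 2) - r"
    using M cM by (simp add: card_Diff_subset finite_subset)
  ultimately have "Max (card ` S) = (2 * r choose 2) - r"
    using fin upper by (intro Max_eqI) (auto simp: image_iff intro: bexI[of _ "[?V]\<^bsup>2\<^esup> - M"])
  then show ?thesis unfolding turan_number_def S_def by simp
qed

section \<open>The contradiction to large minimum degree\<close>

text \<open>
  A hypothetical graph in which every vertex has larger product degree than the pattern, with
  \<open>d\<close> the defect and \<open>cost\<close> the logarithmic loss of a pair in units of \<open>B\<close>. In this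
  normalisation a pair of defect 1 costs 1, a pair of defect at least 2 costs at least
  \<open>A / B = y / x\<close>, and each vertex of the pattern has average cost \<open>y\<close>. The extension principle is
  what the degree assumption gives by averaging over the vertices outside \<open>X\<close>. The assumptions
  are contradictory; the locale hosts the steps of the refutation.
\<close>

locale dense_defect_system =
  fixes V :: "'a set" and d :: "'a set \<Rightarrow> int" and cost :: "'a set \<Rightarrow> real"
    and r :: nat and x y :: real
  assumes r_ge_2: "2 \<le> r"
    and weights_sum: "x + (real r - 1) * y = 1"
    and y_pos: "0 < y"
    and y_less: "y < 3 * x"
    and V_nonempty: "V \<noteq> {}"
    and defect_large: "\<And>X. X \<subseteq> V \<Longrightarrow> finite X \<Longrightarrow> card X = 2 * r \<Longrightarrow> int r + 1 \<le> (\<Sum>e\<in>[X]\<^bsup>2\<^esup>. d e)"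
    and cost_ge: "\<And>e. e \<in> [V]\<^bsup>2\<^esup> \<Longrightarrow> real_of_int (d e) \<le> cost e"
    and cost_ge_2: "\<And>e. e \<in> [V]\<^bsup>2\<^esup> \<Longrightarrow> 2 \<le> d e \<Longrightarrow> y \<le> x * cost e"
    and extension: "\<And>X p. X \<subseteq> V \<Longrightarrow> finite X \<Longrightarrow> X \<noteq> {} \<Longrightarrow> card X \<le> 2 * r + 1 \<Longrightarrow>
          (\<And>v. v \<in> X \<Longrightarrow> 0 \<le> p v) \<Longrightarrow> sum p X = 1 \<Longrightarrow>
          \<exists>u\<in>V - X. (\<Sum>v\<in>X. p v * cost {u, v}) < y"
begin

definition defect :: "'a set \<Rightarrow> int" where
  "defect X = (\<Sum>e\<in>[X]\<^bsup>2\<^esup>. d e)"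

definition defect_to :: "'a \<Rightarrow> 'a set \<Rightarrow> int" where
  "defect_to u X = (\<Sum>v\<in>X. d {u, v})"

lemma x_pos: "0 < x"
  using y_pos y_less by linarith

lemma defect_insert:
  "finite X \<Longrightarrow> u \<notin> X \<Longrightarrow> defect (insert u X) = defect X + defect_to u X"
  unfolding defect_def defect_to_def by (rule sum_nsets_2_insert)

lemma defect_remove:
  assumes "finite X" "u \<in> X"
  shows "defect (X - {u}) = defect X - defect_to u (X - {u})"
  using defect_insert[of "X - {u}" u] assms by (simp add: insert_absorb)

lemma defect_to_remove:
  assumes "finite X" "v \<in> X"
  shows "defect_to u (X - {v}) = defect_to u X - d {u, v}"
  using assms by (simp add: defect_to_def sum_diff1)

lemma defect_to_insert:
  assumes "finite X" "v \<notin> X"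
  shows "defect_to u (insert v X) = d {u, v} + defect_to u X"
  using assms by (simp add: defect_to_def)

lemma defect_remove2:
  assumes "finite X" "u \<in> X" "v \<in> X" "u \<noteq> v"
  shows "defect (X - {u, v}) =
    defect X - defect_to u (X - {u}) - defect_to v (X - {v}) + d {u, v}"
proof -
  have "X - {u, v} = X - {u} - {v}" "X - {v} - {u} = X - {u} - {v}" by auto
  then show ?thesis
    using assms defect_remove[of X u] defect_remove[of "X - {u}" v]
      defect_to_remove[of "X - {v}" u v]
    by (simp add: insert_commute)
qed

lemma defect_remove3:
  assumes "finite X" "u \<in> X" "v \<in> X" "w \<in> X" "u \<noteq> v" "u \<noteq> w" "v \<noteq> w"
  shows "defect (X - {u, v, w}) =
    defect X - defect_to u (X - {u}) - defect_to v (X - {v}) - defect_to w (X - {w})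
      + d {u, v} + d {u, w} + d {v, w}"
proof -
  have *: "X - {u, v, w} = X - {u} - {v, w}" "X - {v} - {u} = X - {u} - {v}"
    "X - {w} - {u} = X - {u} - {w}" by auto
  show ?thesis
    unfolding *(1)
    using assms defect_remove[of X u] defect_remove2[of "X - {u}" v w]
      defect_to_remove[of "X - {v}" u v] defect_to_remove[of "X - {w}" u w] *
    by (simp add: insert_commute)
qed

lemma pair_in_V: "u \<in> V \<Longrightarrow> v \<in> V \<Longrightarrow> u \<noteq> v \<Longrightarrow> {u, v} \<in> [V]\<^bsup>2\<^esup>"
  by (simp add: nsets_def card_insert_if)

text \<open>
  All weights used below take one value on a distinguished set \<open>P\<close> and another on the rest.
\<close>

lemma extension_two_weights:
  assumes "X \<subseteq> V" "finite X" "X \<noteq> {}" "card X \<le> 2 * r + 1" "P \<subseteq> X"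
    and "0 \<le> \<alpha>" "0 \<le> \<beta>" "real (card P) * \<alpha> + (real (card X) - real (card P)) * \<beta> = 1"
  obtains u where "u \<in> V" "u \<notin> X"
    "\<alpha> * (\<Sum>v\<in>P. cost {u, v}) + \<beta> * (\<Sum>v\<in>X - P. cost {u, v}) < y"
    "\<alpha> * real_of_int (defect_to u P) + \<beta> * real_of_int (defect_to u (X - P)) < y"
proof -
  define p where "p v = (if v \<in> P then \<alpha> else \<beta>)" for v
  have fin: "finite P" "finite (X - P)" using assms finite_subset by auto
  have split: "sum g X = sum g P + sum g (X - P)" for g :: "'a \<Rightarrow> real"
    using assms by (metis add.commute sum.subset_diff)
  have 1: "sum p X = 1"
    unfolding split using assms fin
    by (simp add: p_def card_Diff_subset of_nat_diff card_mono)
  have p0: "0 \<le> p v" for v using assms by (simp add: p_def)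
  obtain u where u: "u \<in> V - X" "(\<Sum>v\<in>X. p v * cost {u, v}) < y"
    using extension[OF assms(1-4), of p] 1 p0 by blast
  have "(\<Sum>v\<in>X. p v * cost {u, v}) = \<alpha> * (\<Sum>v\<in>P. cost {u, v}) + \<beta> * (\<Sum>v\<in>X - P. cost {u, v})"
    unfolding split by (simp add: p_def sum_distrib_left)
  then have c: "\<alpha> * (\<Sum>v\<in>P. cost {u, v}) + \<beta> * (\<Sum>v\<in>X - P. cost {u, v}) < y"
    using u by simp
  have le: "real_of_int (defect_to u Q) \<le> (\<Sum>v\<in>Q. cost {u, v})" if "Q \<subseteq> X" for Q
    unfolding defect_to_def of_int_sum
    using that u assms by (intro sum_mono cost_ge pair_in_V) auto
  have "\<alpha> * real_of_int (defect_to u P) + \<beta> * real_of_int (defect_to u (X - P)) < y"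
    using c mult_left_mono[OF le[of P], of \<alpha>] mult_left_mono[OF le[of "X - P"], of \<beta>] assms
    by auto
  with c u show thesis using that by auto
qed

text \<open>
  The smallest total defect of a set of \<open>k\<close> vertices: \<open>r\<close> vertices from different parts of the
  pattern have defect 0, each further vertex repeats a part and adds 1, and the
  last one, completing a \<open>2r\<close>-set, adds 2.
\<close>

definition min_defect :: "nat \<Rightarrow> int" where
  "min_defect k = (if k \<le> r then 0 else if k < 2 * r then int k - int r else int r + 1)"

lemma min_defect_near_top:
  "min_defect (2 * r) = int r + 1"
  "min_defect (2 * r - 1) = int r - 1"
  "min_defect (2 * r - 2) = int r - 2"
  using r_ge_2 by (auto simp: min_defect_def of_nat_diff)

text \<open>
  With uniform weights on \<open>k\<close> vertices a new vertex of defect less than \<open>k y\<close> exists. From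
  \<open>x > 0\<close> and \<open>y < 3 x\<close> follow \<open>(r - 1) y < 1\<close> and \<open>(3r - 2) y < 3\<close>, which bound \<open>k y\<close> by 1, 2 and 3 in the
  three ranges of \<open>min_defect\<close>.
\<close>

lemma uniform_extension:
  assumes "X \<subseteq> V" "finite X" "1 \<le> card X" "card X < 2 * r"
  obtains u where "u \<in> V" "u \<notin> X" "defect_to u X \<le> min_defect (Suc (card X)) - min_defect (card X)"
proof -
  define k where "k = card X"
  have ne: "X \<noteq> {}" using assms by auto
  obtain u where u: "u \<in> V" "u \<notin> X" "1 / real k * real_of_int (defect_to u X) < y"
    using extension_two_weights[of X X "1 / real k" 0] assms ne
    unfolding k_def by (auto simp: card_gt_0_iff)
  have lt: "real_of_int (defect_to u X) < real k * y"
    using u assms unfolding k_def by (simp add: field_simps)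
  have y1: "(real r - 1) * y < 1" using weights_sum x_pos by linarith
  have y3: "(3 * real r - 2) * y < 3" using weights_sum y_less by (simp add: algebra_simps)
  have mono: "real k * y \<le> c * y" if "real k \<le> c" for c
    using that y_pos by (intro mult_right_mono) auto
  consider "k < r" | "r \<le> k" "k < 2 * r - 1" | "k = 2 * r - 1" "k \<ge> r"
    using assms unfolding k_def by linarith
  then have "defect_to u X \<le> min_defect (Suc k) - min_defect k"
  proof cases
    case 1
    have "real k * y \<le> (real r - 1) * y" by (rule mono) (use 1 in linarith)
    then have "real_of_int (defect_to u X) < 1" using lt y1 by linarith
    then show ?thesis using 1 by (simp add: min_defect_def)
  next
    case 2
    have "real k * y \<le> (2 * (real r - 1)) * y"
    proof (rule mono)
      have "k + 2 \<le> 2 * r" using 2 by linarith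
      then have "real (k + 2) \<le> real (2 * r)" by (rule of_nat_mono)
      then show "real k \<le> 2 * (real r - 1)" by simp
    qed
    then have "real_of_int (defect_to u X) < 2" using lt y1 by linarith
    then have "defect_to u X \<le> 1" by linarith
    moreover have "Suc k < 2 * r" using 2 by linarith
    ultimately show ?thesis using 2 by (auto simp: min_defect_def)
  next
    case 3
    have "real k * y \<le> (3 * real r - 2) * y" by (rule mono) (use 3 r_ge_2 in linarith)
    then have "real_of_int (defect_to u X) < 3" using lt y3 by linarith
    then have "defect_to u X \<le> 2" by linarith
    then show ?thesis using 3 r_ge_2 by (auto simp: min_defect_def)
  qed
  then show thesis using that u by (simp add: k_def)
qed

text \<open>
  A set below the bound could be extended, staying below the bound, to a \<open>2r\<close>-set, where
  the sparsity assumption forbids it.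
\<close>

lemma defect_ge_min_defect:
  assumes "X \<subseteq> V" "finite X" "1 \<le> card X" "card X \<le> 2 * r"
  shows "min_defect (card X) \<le> defect X"
  using assms
proof (induction "2 * r - card X" arbitrary: X)
  case 0
  then show ?case using defect_large[of X] r_ge_2 by (simp add: min_defect_def defect_def)
next
  case (Suc k)
  then have "card X < 2 * r" by linarith
  with Suc obtain u where u: "u \<in> V" "u \<notin> X"
      "defect_to u X \<le> min_defect (Suc (card X)) - min_defect (card X)"
    using uniform_extension[of X] by blast
  have "min_defect (card (insert u X)) \<le> defect (insert u X)"
    using Suc u by (intro Suc.hyps(1)) auto
  then show ?case using u Suc.prems by (simp add: defect_insert)
qed

text \<open>
  The case of two vertices: no multiplicity exceeds \<open>a + 1\<close>.
\<close>

lemma d_nonneg: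
  assumes "u \<in> V" "v \<in> V" "u \<noteq> v"
  shows "0 \<le> d {u, v}"
proof -
  have "[{u, v}]\<^bsup>2\<^esup> = {{u, v}}"
    using assms by (auto simp: nsets_def card_insert_if dest: card_subset_eq[rotated])
  then show ?thesis
    using defect_ge_min_defect[of "{u, v}"] assms r_ge_2
    by (simp add: min_defect_def defect_def)
qed

lemma exists_defect_le:
  assumes "1 \<le> k" "k \<le> 2 * r"
  shows "\<exists>X\<subseteq>V. finite X \<and> card X = k \<and> defect X \<le> min_defect k"
  using assms
proof (induction k rule: dec_induct)
  case base
  obtain v where "v \<in> V" using V_nonempty by auto
  moreover have "[{v}]\<^bsup>2\<^esup> = {}" by (auto simp: nsets_def card_2_iff)
  ultimately show ?case
    by (intro exI[of _ "{v}"]) (use r_ge_2 in \<open>auto simp: defect_def min_defect_def\<close>)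
next
  case (step k)
  then obtain X where X: "X \<subseteq> V" "finite X" "card X = k" "defect X \<le> min_defect k" by auto
  obtain u where "u \<in> V" "u \<notin> X" "defect_to u X \<le> min_defect (Suc k) - min_defect k"
    using uniform_extension[of X] X step by auto
  then show ?case
    using X by (intro exI[of _ "insert u X"]) (auto simp: defect_insert)
qed


text \<open>
  The handshake identity, which turns upper bounds on the degrees of a set of known defect into
  equalities.
\<close>

lemma sum_defect_to:
  "finite X \<Longrightarrow> (\<Sum>v\<in>X. defect_to v (X - {v})) = 2 * defect X"
proof (induction X rule: finite_induct)
  case empty
  have "[{} :: 'a set]\<^bsup>2\<^esup> = {}" by (auto simp: nsets_def)
  then show ?case by (simp add: defect_def)
next
  case (insert u X)
  have "defect_to v (insert u X - {v}) = d {u, v} + defect_to v (X - {v})" if "v \<in> X" for v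
  proof -
    have "insert u X - {v} = insert u (X - {v})" using that insert by auto
    then show ?thesis using that insert by (simp add: defect_to_insert insert_commute)
  qed
  then have "(\<Sum>v\<in>X. defect_to v (insert u X - {v})) = defect_to u X + 2 * defect X"
    using insert by (simp add: sum.distrib defect_to_def)
  then show ?case using insert by (simp add: defect_insert)
qed

lemma defect_to_diff:
  "finite X \<Longrightarrow> Z \<subseteq> X \<Longrightarrow> defect_to u (X - Z) = defect_to u X - defect_to u Z"
  by (simp add: defect_to_def sum_diff)

lemma defect_to_nonneg:
  "u \<in> V \<Longrightarrow> Q \<subseteq> V \<Longrightarrow> u \<notin> Q \<Longrightarrow> 0 \<le> defect_to u Q"
  unfolding defect_to_def by (intro sum_nonneg d_nonneg) auto

text \<open>
  The bound \<open>min_defect\<close> after replacing \<open>Z\<close> by \<open>t\<close>. If the vertices of \<open>Z\<close> carry much of the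
  defect of \<open>Y\<close>, then \<open>t\<close> must have large defect to the remaining vertices.
\<close>

lemma defect_after_exchange:
  assumes "Y \<subseteq> V" "finite Y" "Z \<subseteq> Y" "t \<in> V" "t \<notin> Y" "Suc (card Y) - card Z \<le> 2 * r"
  shows "min_defect (Suc (card Y) - card Z) \<le>
    defect (Y - Z) + defect_to t Y - defect_to t Z"
proof -
  have fin: "finite Z" using assms finite_subset by auto
  have card: "card (insert t (Y - Z)) = Suc (card Y) - card Z"
    using assms fin card_mono[of Y Z] by (simp add: card_Diff_subset)
  have "min_defect (card (insert t (Y - Z))) \<le> defect (insert t (Y - Z))"
  proof (rule defect_ge_min_defect)
    show "1 \<le> card (insert t (Y - Z))" using assms by (simp add: card_insert_if)
    show "card (insert t (Y - Z)) \<le> 2 * r" unfolding card by (rule assms)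
  qed (use assms in auto)
  then show ?thesis
    using assms card by (simp add: defect_insert defect_to_diff)
qed

text \<open>
  A tight set of \<open>2r - 1\<close> vertices has defect \<open>r - 1\<close>. Removing a vertex of degree 2 would
  violate the bound for \<open>2r - 2\<close> vertices, so all degrees are at most 1, and by the handshake
  identity all but one of them are equal to 1.
\<close>

lemma exists_near_matching:
  obtains X z where "X \<subseteq> V" "finite X" "card X = 2 * r - 1" "defect X = int r - 1" "z \<in> X"
    "defect_to z (X - {z}) = 0" "\<And>v. v \<in> X \<Longrightarrow> v \<noteq> z \<Longrightarrow> defect_to v (X - {v}) = 1"
proof -
  obtain X where X: "X \<subseteq> V" "finite X" "card X = 2 * r - 1" "defect X \<le> int r - 1"
    using exists_defect_le[of "2 * r - 1", unfolded min_defect_near_top] r_ge_2 by fastforce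
  have DX: "defect X = int r - 1"
  proof -
    have "min_defect (2 * r - 1) \<le> defect X"
      using defect_ge_min_defect[of X] X r_ge_2 by simp
    then show ?thesis using X(4) unfolding min_defect_near_top by simp
  qed
  have deg_le: "defect_to v (X - {v}) \<le> 1" if "v \<in> X" for v
  proof -
    have "card (X - {v}) = 2 * r - 2" using X that by simp
    then have "min_defect (2 * r - 2) \<le> defect (X - {v})"
      using X(1,2) r_ge_2 defect_ge_min_defect[of "X - {v}"] by (simp add: subset_trans[OF Diff_subset])
    then show ?thesis
      using X that DX min_defect_near_top by (simp add: defect_remove)
  qed
  have "(\<Sum>v\<in>X. 1 - defect_to v (X - {v})) = 1"
    using X DX r_ge_2 by (simp add: sum_subtractf sum_defect_to of_nat_diff)
  then obtain z where "z \<in> X" "1 - defect_to z (X - {z}) = 1"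
    "\<And>v. v \<in> X \<Longrightarrow> v \<noteq> z \<Longrightarrow> 1 - defect_to v (X - {v}) = 0"
    by (rule sum_eq_one_int[rotated 2]) (use X deg_le in auto)
  then show thesis using that[of X z] X DX by auto
qed

lemma zero_if_defect_to_zero:
  assumes "v \<in> V" "Q \<subseteq> V" "finite Q" "v \<notin> Q" "defect_to v Q = 0" "w \<in> Q"
  shows "d {v, w} = 0"
  using assms sum_nonneg_eq_0_iff[of Q "\<lambda>w. d {v, w}"] d_nonneg
  unfolding defect_to_def by (metis subsetD)

lemma unique_if_defect_to_one:
  assumes "v \<in> V" "Q \<subseteq> V" "finite Q" "v \<notin> Q" "defect_to v Q = 1"
  obtains w where "w \<in> Q" "d {v, w} = 1" "\<And>w'. w' \<in> Q \<Longrightarrow> w' \<noteq> w \<Longrightarrow> d {v, w'} = 0"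
proof (rule sum_eq_one_int[of Q "\<lambda>w. d {v, w}"])
  show "0 \<le> d {v, w}" if "w \<in> Q" for w using that assms by (intro d_nonneg) auto
  show "(\<Sum>w\<in>Q. d {v, w}) = 1" using assms by (simp add: defect_to_def)
qed (use assms that in auto)

text \<open>
  In the near-matching with isolated vertex \<open>z\<close>, put weight \<open>x\<close> on \<open>z\<close> and \<open>y / 2\<close> on the matched
  vertices. The new vertex \<open>u\<close> has total defect at least 2 by sparsity, while two
  units on \<open>z\<close>, or two units on the matching, already cost \<open>y\<close>. So \<open>u\<close> sends one unit to \<open>z\<close> and
  one to a matched vertex \<open>m\<close>, which has partner \<open>m'\<close>.
\<close>

lemma exists_path:
  obtains Y z u m m' where "Y \<subseteq> V" "finite Y" "card Y = 2 * r" "defect Y = int r + 1"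
    "{z, u, m, m'} \<subseteq> Y" "distinct [z, u, m, m']"
    "d {z, u} = 1" "d {u, m} = 1" "d {m, m'} = 1"
    "d {z, m} = 0" "d {z, m'} = 0" "d {u, m'} = 0"
    "\<forall>j\<in>Y - {z, u, m, m'}. \<forall>v\<in>{z, u, m, m'}. d {v, j} = 0"
    "\<forall>j\<in>Y - {z, u, m, m'}. defect_to j (Y - {j}) = 1"
    "defect_to z (Y - {z}) = 1" "defect_to u (Y - {u}) = 2"
    "defect_to m (Y - {m}) = 2" "defect_to m' (Y - {m'}) = 1"
proof -
  obtain X z where X: "X \<subseteq> V" "finite X" "card X = 2 * r - 1" "defect X = int r - 1" "z \<in> X"
    "defect_to z (X - {z}) = 0" and deg: "\<And>v. v \<in> X \<Longrightarrow> v \<noteq> z \<Longrightarrow> defect_to v (X - {v}) = 1"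
    by (rule exists_near_matching) blast
  have z0: "d {z, v} = 0" if "v \<in> X" "v \<noteq> z" for v
    using zero_if_defect_to_zero[of z "X - {z}" v] X that by auto
  obtain u where u: "u \<in> V" "u \<notin> X"
    "x * (\<Sum>v\<in>{z}. cost {u, v}) + y / 2 * (\<Sum>v\<in>X - {z}. cost {u, v}) < y"
    "x * real_of_int (defect_to u {z}) + y / 2 * real_of_int (defect_to u (X - {z})) < y"
  proof (rule extension_two_weights[of X "{z}" x "y / 2"])
    show "real (card {z}) * x + (real (card X) - real (card {z})) * (y / 2) = 1"
      using X weights_sum r_ge_2 by (simp add: of_nat_diff field_simps)
  qed (use X x_pos y_pos r_ge_2 in auto)
  have zu: "z \<in> V" "z \<noteq> u" using X u by auto
  have fz: "defect_to u {z} = d {u, z}" by (simp add: defect_to_def)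
  have Dz0: "0 \<le> d {u, z}" using d_nonneg zu u by auto
  have DM0: "0 \<le> defect_to u (X - {z})" using X u by (intro defect_to_nonneg) auto
  have total: "2 \<le> d {u, z} + defect_to u (X - {z})"
  proof -
    have "min_defect (2 * r) \<le> defect (insert u X)"
      using X u r_ge_2 defect_ge_min_defect[of "insert u X"] by auto
    then show ?thesis
      using X u min_defect_near_top fz by (simp add: defect_insert defect_to_diff)
  qed
  have dz: "d {u, z} \<le> 1"
  proof (rule ccontr)
    assume "\<not> ?thesis"
    then have "y \<le> x * cost {u, z}" using zu u by (intro cost_ge_2 pair_in_V) auto
    moreover have "0 \<le> cost {u, v}" if "v \<in> X - {z}" for v
    proof -
      have "u \<noteq> v" "v \<in> V" using that X u by auto
      then show ?thesis
        using d_nonneg[of u v] cost_ge[of "{u, v}"] pair_in_V u by fastforce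
    qed
    then have "0 \<le> y / 2 * (\<Sum>v\<in>X - {z}. cost {u, v})"
      using y_pos by (intro mult_nonneg_nonneg sum_nonneg) auto
    ultimately show False using u(3) by simp
  qed
  have dM: "defect_to u (X - {z}) \<le> 1"
  proof (rule ccontr)
    assume "\<not> ?thesis"
    then have "y / 2 * 2 \<le> y / 2 * real_of_int (defect_to u (X - {z}))"
      using y_pos by (intro mult_left_mono) auto
    moreover have "0 \<le> x * real_of_int (d {u, z})" using x_pos Dz0 by simp
    ultimately show False using u(4) fz by simp
  qed
  have uz: "d {u, z} = 1" and uM: "defect_to u (X - {z}) = 1" using dz dM total by auto
  obtain m where m: "m \<in> X - {z}" "d {u, m} = 1" and
    u0: "\<And>v. v \<in> X - {z} \<Longrightarrow> v \<noteq> m \<Longrightarrow> d {u, v} = 0"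
    by (rule unique_if_defect_to_one[of u "X - {z}"]) (use X u uM in auto)
  have degm: "defect_to m (X - {m}) = 1" using deg m by auto
  obtain m' where m': "m' \<in> X - {m}" "d {m, m'} = 1" and
    m0: "\<And>v. v \<in> X - {m} \<Longrightarrow> v \<noteq> m' \<Longrightarrow> d {m, v} = 0"
    by (rule unique_if_defect_to_one[of m "X - {m}"]) (use X m degm in auto)
  have m'z: "m' \<noteq> z" using z0[of m] m m' by (auto simp: insert_commute)
  have degm': "defect_to m' (X - {m'}) = 1" using deg m' m'z by auto
  have m'0: "d {m', v} = 0" if v: "v \<in> X" "v \<noteq> m" "v \<noteq> m'" for v
  proof -
    obtain w where w: "w \<in> X - {m'}" "d {m', w} = 1"
      "\<And>v. v \<in> X - {m'} \<Longrightarrow> v \<noteq> w \<Longrightarrow> d {m', v} = 0"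
      by (rule unique_if_defect_to_one[of m' "X - {m'}"]) (use X m' degm' in auto)
    have "w = m" using w(3)[of m] m m' by (auto simp: insert_commute)
    then show ?thesis using w v by auto
  qed
  define Y where "Y = insert u X"
  have degY: "defect_to v (Y - {v}) = d {u, v} + defect_to v (X - {v})" if "v \<in> X" for v
  proof -
    have "Y - {v} = insert u (X - {v})" using that u Y_def by auto
    then show ?thesis using that X u by (simp add: defect_to_insert insert_commute)
  qed
  have Y: "Y \<subseteq> V" "finite Y" "card Y = 2 * r" "defect Y = int r + 1"
    using X u r_ge_2 fz uz uM unfolding Y_def
    by (auto simp: defect_insert defect_to_diff)
  have degu: "defect_to u (Y - {u}) = 2"
    using X u fz uz uM unfolding Y_def by (simp add: defect_to_diff)
  show thesis
  proof (rule that[of Y z u m m'])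
    show "\<forall>j\<in>Y - {z, u, m, m'}. \<forall>v\<in>{z, u, m, m'}. d {v, j} = 0"
      using z0 u0 m0 m'0 unfolding Y_def by auto
    show "\<forall>j\<in>Y - {z, u, m, m'}. defect_to j (Y - {j}) = 1"
    proof
      fix j assume "j \<in> Y - {z, u, m, m'}"
      then show "defect_to j (Y - {j}) = 1"
        using degY[of j] deg[of j] u0[of j] unfolding Y_def by auto
    qed
    show "{z, u, m, m'} \<subseteq> Y" "distinct [z, u, m, m']"
      using X m m' m'z u by (auto simp: Y_def)
    show zu1: "d {z, u} = 1" using uz by (simp add: insert_commute)
    show zm: "d {z, m} = 0" and zm': "d {z, m'} = 0" using z0 m m' m'z by auto
    show um': "d {u, m'} = 0" using u0 m' m'z by auto
    show "defect_to z (Y - {z}) = 1" using degY[of z] X uz by simp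
    show "defect_to m (Y - {m}) = 2" using degY[of m] m degm by simp
    show "defect_to m' (Y - {m'}) = 1" using degY[of m'] m' degm' um' by simp
  qed (fact Y m m' degu)+
qed

text \<open>
  With weight \<open>(x + y) / 4 \<ge> y / 3\<close> on the path and \<open>y / 2\<close> on the matching, the new vertex \<open>t\<close> has
  total defect at most 2. Exchanging \<open>t\<close> for one of the inner vertices \<open>u\<close> and \<open>m\<close>, whose degree
  is 2, shows that exactly 2 units are sent, none of them to \<open>u\<close> or \<open>m\<close>. Exchanges against independent
  sets that contain an inner vertex leave only one possibility: one unit to each end of the path.
\<close>

lemma exists_pentagon:
  obtains W z u m m' t where "W \<subseteq> V" "finite W" "card W = 2 * r + 1" "defect W = int r + 3"
    "{z, u, m, m', t} \<subseteq> W" "distinct [z, u, m, m', t]"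
    "d {z, m} = 0" "d {z, m'} = 0" "d {u, m'} = 0" "d {u, t} = 0" "d {m, t} = 0"
    "\<forall>v\<in>{z, u, m, m', t}. defect_to v (W - {v}) = 2"
proof -
  obtain Y z u m m' where Y: "Y \<subseteq> V" "finite Y" "card Y = 2 * r" "defect Y = int r + 1"
    and P: "{z, u, m, m'} \<subseteq> Y" "distinct [z, u, m, m']"
    and adj: "d {z, u} = 1" "d {u, m} = 1" "d {m, m'} = 1"
    and nonadj: "d {z, m} = 0" "d {z, m'} = 0" "d {u, m'} = 0"
    and J0: "\<forall>j\<in>Y - {z, u, m, m'}. \<forall>v\<in>{z, u, m, m'}. d {v, j} = 0"
    and J1: "\<forall>j\<in>Y - {z, u, m, m'}. defect_to j (Y - {j}) = 1"
    and deg: "defect_to z (Y - {z}) = 1" "defect_to u (Y - {u}) = 2"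
      "defect_to m (Y - {m}) = 2" "defect_to m' (Y - {m'}) = 1"
    using exists_path by blast
  let ?P = "{z, u, m, m'}"
  have cP: "card ?P = 4" using P by simp
  define \<alpha> where "\<alpha> = (x + y) / 4"
  have \<alpha>: "0 < \<alpha>" "y \<le> 3 * \<alpha>" using x_pos y_pos y_less by (auto simp: \<alpha>_def)
  obtain t where t: "t \<in> V" "t \<notin> Y"
    "\<alpha> * real_of_int (defect_to t ?P) + y / 2 * real_of_int (defect_to t (Y - ?P)) < y"
  proof (rule extension_two_weights[of Y ?P \<alpha> "y / 2"])
    show "real (card ?P) * \<alpha> + (real (card Y) - real (card ?P)) * (y / 2) = 1"
      unfolding cP using Y weights_sum by (simp add: \<alpha>_def field_simps)
  qed (use Y P \<alpha> y_pos r_ge_2 in auto)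
  define R where "R = defect_to t (Y - ?P)"
  have S: "defect_to t ?P = d {t, z} + d {t, u} + d {t, m} + d {t, m'}"
    using P by (simp add: defect_to_def)
  have nn: "0 \<le> d {t, v}" if "v \<in> Y" for v using d_nonneg t Y that by auto
  have nnP: "0 \<le> d {t, z}" "0 \<le> d {t, u}" "0 \<le> d {t, m}" "0 \<le> d {t, m'}"
    using nn P by auto
  have R0: "0 \<le> R" unfolding R_def using Y t by (intro defect_to_nonneg) auto
  have tY: "defect_to t Y = d {t, z} + d {t, u} + d {t, m} + d {t, m'} + R"
    using defect_to_diff[of Y ?P t] Y P S by (simp add: R_def)
  have R1: "R \<le> 1"
  proof (rule ccontr)
    assume "\<not> R \<le> 1"
    then have "y / 2 * 2 \<le> y / 2 * real_of_int R" using y_pos by (intro mult_left_mono) auto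
    moreover have "0 \<le> \<alpha> * real_of_int (defect_to t ?P)" using \<alpha> S nnP by simp
    ultimately show False using t(3) R_def by simp
  qed
  have SR: "defect_to t ?P + R \<le> 2"
  proof (rule ccontr)
    assume *: "\<not> ?thesis"
    consider "R = 0" | "R = 1" using R0 R1 by linarith
    then show False
    proof cases
      case 1
      then have "\<alpha> * 3 \<le> \<alpha> * real_of_int (defect_to t ?P)" using \<alpha> * by (intro mult_left_mono) auto
      moreover have "\<alpha> * real_of_int (defect_to t ?P) < y" using t(3) 1 R_def by simp
      ultimately show False using \<alpha> by linarith
    next
      case 2
      then have "\<alpha> * 2 \<le> \<alpha> * real_of_int (defect_to t ?P)" using \<alpha> * by (intro mult_left_mono) auto
      moreover have "\<alpha> * real_of_int (defect_to t ?P) + y / 2 < y" using t(3) 2 R_def by simp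
      ultimately show False using \<alpha> y_pos by linarith
    qed
  qed
  note ex = defect_after_exchange[OF Y(1,2) _ t(1,2)]
  \<comment> \<open>the exchanged sets have \<open>2r\<close> vertices\<close>
  have eu: "2 \<le> defect_to t Y - d {t, u}"
    using ex[of "{u}"] Y P deg min_defect_near_top by (simp add: defect_remove defect_to_def)
  have em: "2 \<le> defect_to t Y - d {t, m}"
    using ex[of "{m}"] Y P deg min_defect_near_top by (simp add: defect_remove defect_to_def)
  have tum: "d {t, u} = 0" "d {t, m} = 0" and SR2: "d {t, z} + d {t, m'} + R = 2"
    using eu em SR S tY nnP by linarith+
  have m'u: "d {m', u} = 0" "m' \<noteq> u" using nonadj P by (auto simp: insert_commute)
  have sub: "Suc (2 * r) - 3 = 2 * r - 2" "Suc (2 * r) - 2 = 2 * r - 1" by auto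
  have R: "R = 0"
  proof (rule ccontr)
    assume "R \<noteq> 0"
    then have R: "R = 1" using R0 R1 by simp
    obtain j where j: "j \<in> Y - ?P" "d {t, j} = 1"
      by (rule unique_if_defect_to_one[of t "Y - ?P"]) (use R R_def t Y in auto)
    have dj: "defect_to j (Y - {j}) = 1" and j0: "\<And>v. v \<in> ?P \<Longrightarrow> d {v, j} = 0"
      using J1 J0 j(1) by blast+
    have ne: "j \<in> Y" "j \<noteq> z" "j \<noteq> u" "j \<noteq> m" "j \<noteq> m'" using j by auto
    \<comment> \<open>A unit sent to the matching at \<open>j\<close> is excluded by exchanges against \<open>{z, m, j}\<close> and
      \<open>{m', u, j}\<close>: one of these sets receives both units.\<close>
    have "defect (Y - {z, m, j}) = int r - 3"
      using defect_remove3[of Y z m j] Y P deg dj j0 nonadj ne by simp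
    moreover have "card {z, m, j} = 3" "defect_to t {z, m, j} = d {t, z} + d {t, m} + d {t, j}"
      using P ne by (auto simp: defect_to_def)
    ultimately have e1: "1 \<le> defect_to t Y - d {t, z} - d {t, m} - d {t, j}"
      using ex[of "{z, m, j}"] P Y ne sub min_defect_near_top by simp
    have "defect (Y - {m', u, j}) = int r - 3"
      using defect_remove3[of Y m' u j] Y P deg dj j0 nonadj m'u ne by simp
    moreover have "card {m', u, j} = 3" "defect_to t {m', u, j} = d {t, m'} + d {t, u} + d {t, j}"
      using P ne by (auto simp: defect_to_def)
    ultimately have e2: "1 \<le> defect_to t Y - d {t, m'} - d {t, u} - d {t, j}"
      using ex[of "{m', u, j}"] P Y ne sub min_defect_near_top by simp
    show False using e1 e2 j tum tY SR2 R by linarith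
  qed
  \<comment> \<open>exchanges against \<open>{z, m}\<close> and \<open>{m', u}\<close> forbid two units to the same end\<close>
  have e1: "1 \<le> defect_to t Y - d {t, z} - d {t, m}"
  proof -
    have "defect (Y - {z, m}) = int r - 2" using defect_remove2[of Y z m] Y P deg nonadj by simp
    moreover have "card {z, m} = 2" "defect_to t {z, m} = d {t, z} + d {t, m}"
      using P by (auto simp: defect_to_def)
    ultimately show ?thesis using ex[of "{z, m}"] P Y sub min_defect_near_top by simp
  qed
  have e2: "1 \<le> defect_to t Y - d {t, m'} - d {t, u}"
  proof -
    have "defect (Y - {m', u}) = int r - 2" using defect_remove2[of Y m' u] Y P deg m'u by simp
    moreover have "card {m', u} = 2" "defect_to t {m', u} = d {t, m'} + d {t, u}"
      using P by (auto simp: defect_to_def)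
    ultimately show ?thesis using ex[of "{m', u}"] P Y sub min_defect_near_top by simp
  qed
  have tzm': "d {t, z} = 1" "d {t, m'} = 1" using e1 e2 R SR2 tum tY by linarith+
  define W where "W = insert t Y"
  have degW: "defect_to v (W - {v}) = d {t, v} + defect_to v (Y - {v})" if "v \<in> Y" for v
  proof -
    have "W - {v} = insert t (Y - {v})" using that t W_def by auto
    then show ?thesis using that Y t by (simp add: defect_to_insert insert_commute)
  qed
  have degt: "defect_to t (W - {t}) = 2" using t tY SR2 tum by (simp add: W_def)
  show thesis
  proof (rule that[of W z u m m' t])
    show "W \<subseteq> V" "finite W" "card W = 2 * r + 1" "defect W = int r + 3"
      using Y t tY SR2 tum by (auto simp: W_def defect_insert)
    show "\<forall>v\<in>{z, u, m, m', t}. defect_to v (W - {v}) = 2"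
      using degW degt deg tum tzm' P by auto
    show "distinct [z, u, m, m', t]" using P t by auto
  qed (use P nonadj tum in \<open>auto simp: W_def insert_commute\<close>)
qed

text \<open>
  Removing any of the five nonadjacent pairs of the 5-cycle leaves defect \<open>r - 1\<close>, so the new
  vertex must send at least 2 units outside each such pair. With \<open>S\<close> units to the cycle and \<open>R\<close>
  to the matching, summing over the five pairs gives \<open>10 \<le> 3 S + 5 R\<close>; all solutions cost at least
  \<open>y\<close>, as the weight \<open>(x + y) / 5\<close> exceeds \<open>4 y / 15\<close>.
\<close>

lemma inconsistent: False
proof -
  obtain W z u m m' t where W: "W \<subseteq> V" "finite W" "card W = 2 * r + 1" "defect W = int r + 3"
    and P: "{z, u, m, m', t} \<subseteq> W" "distinct [z, u, m, m', t]"
    and nonadj: "d {z, m} = 0" "d {z, m'} = 0" "d {u, m'} = 0" "d {u, t} = 0" "d {m, t} = 0"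
    and deg: "\<forall>v\<in>{z, u, m, m', t}. defect_to v (W - {v}) = 2"
    using exists_pentagon by blast
  let ?P = "{z, u, m, m', t}"
  have cP: "card ?P = 5" using P by simp
  define \<alpha> where "\<alpha> = (x + y) / 5"
  have \<alpha>: "0 < \<alpha>" "4 * y \<le> 15 * \<alpha>" using x_pos y_pos y_less by (auto simp: \<alpha>_def)
  obtain s where s: "s \<in> V" "s \<notin> W"
    "\<alpha> * real_of_int (defect_to s ?P) + y / 2 * real_of_int (defect_to s (W - ?P)) < y"
  proof (rule extension_two_weights[of W ?P \<alpha> "y / 2"])
    show "real (card ?P) * \<alpha> + (real (card W) - real (card ?P)) * (y / 2) = 1"
      unfolding cP using W weights_sum by (simp add: \<alpha>_def field_simps)
  qed (use W P \<alpha> y_pos r_ge_2 in auto)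
  define R where "R = defect_to s (W - ?P)"
  define S where "S = defect_to s ?P"
  have S: "S = d {s, z} + d {s, u} + d {s, m} + d {s, m'} + d {s, t}"
    using P by (simp add: S_def defect_to_def)
  have sW: "defect_to s W = S + R"
    using defect_to_diff[of W ?P s] W P by (simp add: R_def S_def)
  have nonneg: "0 \<le> S" "0 \<le> R"
    unfolding R_def S_def using W P s by (auto intro!: defect_to_nonneg)
  have two: "2 \<le> S + R - d {s, a} - d {s, b}"
    if "a \<in> ?P" "b \<in> ?P" "a \<noteq> b" "d {a, b} = 0" for a b
  proof -
    have ab: "{a, b} \<subseteq> W" using that P by blast
    have "defect (W - {a, b}) = int r - 1"
      using defect_remove2[of W a b] W that(3,4) bspec[OF deg that(1)] bspec[OF deg that(2)] ab
      by simp
    then show ?thesis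
      using defect_after_exchange[OF W(1,2) ab s(1,2)] W that sW min_defect_near_top
      by (simp add: defect_to_def)
  qed
  have "10 \<le> 3 * S + 5 * R"
    using two[of z m] two[of z m'] two[of u m'] two[of u t] two[of m t] nonadj P S by simp
  then have "2 \<le> R \<or> R = 1 \<and> 2 \<le> S \<or> R = 0 \<and> 4 \<le> S" using nonneg by linarith
  moreover have lower: "\<alpha> * real i + y / 2 * real j < y" if "int i \<le> S" "int j \<le> R" for i j
  proof -
    have "\<alpha> * real i \<le> \<alpha> * real_of_int S" "y / 2 * real j \<le> y / 2 * real_of_int R"
      using that \<alpha> y_pos by (auto intro!: mult_left_mono)
    then show ?thesis using s(3) by (simp add: R_def S_def)
  qed
  ultimately show False
    using lower[of 0 2] lower[of 2 1] lower[of 4 0] \<alpha> y_pos nonneg by auto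
qed

end

section \<open>The extremal pattern\<close>

text \<open>
  The pattern for a map \<open>\<phi>\<close> from vertices to part numbers; part 0 is the special one.
\<close>

definition blowup :: "nat \<Rightarrow> ('a \<Rightarrow> nat) \<Rightarrow> 'a set \<Rightarrow> nat" where
  "blowup a \<phi> e =
     (if e \<subseteq> \<phi> -` {0} then a - 1 else if \<exists>i. e \<subseteq> \<phi> -` {i} then a else a + 1)"

text \<open>
  Used with \<open>g\<close> the embedding into the reals for the sparsity of the pattern and with \<open>g\<close> the
  logarithm for its product.
\<close>

lemma sum_blowup:
  fixes g :: "nat \<Rightarrow> real"
  assumes "finite X" "\<And>v. v \<in> X \<Longrightarrow> \<phi> v < r" "1 \<le> r"
  shows "(\<Sum>e\<in>[X]\<^bsup>2\<^esup>. g (blowup a \<phi> e)) =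
    real (card X choose 2) * g (a + 1)
    - (g (a + 1) - g (a - 1)) * real (card (X \<inter> \<phi> -` {0}) choose 2)
    - (g (a + 1) - g a) * (\<Sum>i = 1..<r. real (card (X \<inter> \<phi> -` {i}) choose 2))"
proof -
  define \<delta> where "\<delta> i = (if i = 0 then g (a + 1) - g (a - 1) else g (a + 1) - g a)" for i :: nat
  have eq: "g (blowup a \<phi> e) = g (a + 1) - (\<Sum>i<r. if e \<subseteq> \<phi> -` {i} then \<delta> i else 0)"
    if e: "e \<in> [X]\<^bsup>2\<^esup>" for e
  proof -
    obtain v where v: "v \<in> e" "e \<subseteq> X" using e by (auto simp: nsets_def card_2_iff)
    have uniq: "i = \<phi> v" if "e \<subseteq> \<phi> -` {i}" for i using that v by auto
    show ?thesis
    proof (cases "e \<subseteq> \<phi> -` {\<phi> v}")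
      case True
      have "e \<subseteq> \<phi> -` {i} \<longleftrightarrow> i = \<phi> v" for i using True uniq by blast
      then have "(\<Sum>i<r. if e \<subseteq> \<phi> -` {i} then \<delta> i else 0) = \<delta> (\<phi> v)"
        and "blowup a \<phi> e = (if \<phi> v = 0 then a - 1 else a)"
        using assms(2)[of v] v by (auto simp: blowup_def)
      then show ?thesis by (simp add: \<delta>_def)
    next
      case False
      then have no: "\<not> e \<subseteq> \<phi> -` {i}" for i using uniq by metis
      then show ?thesis by (simp add: blowup_def)
    qed
  qed
  have count: "(\<Sum>e\<in>[X]\<^bsup>2\<^esup>. if e \<subseteq> \<phi> -` {i} then \<delta> i else 0) =
      \<delta> i * real (card (X \<inter> \<phi> -` {i}) choose 2)" for i
  proof -
    have "{e \<in> [X]\<^bsup>2\<^esup>. e \<subseteq> \<phi> -` {i}} = [X \<inter> \<phi> -` {i}]\<^bsup>2\<^esup>" by (auto simp: nsets_def)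
    then show ?thesis using assms(1) by (simp flip: sum.inter_filter)
  qed
  have r: "{..<r} = insert 0 {1..<r}" using assms(3) by auto
  have "(\<Sum>e\<in>[X]\<^bsup>2\<^esup>. g (blowup a \<phi> e)) =
      (\<Sum>e\<in>[X]\<^bsup>2\<^esup>. g (a + 1)) - (\<Sum>i<r. \<Sum>e\<in>[X]\<^bsup>2\<^esup>. if e \<subseteq> \<phi> -` {i} then \<delta> i else 0)"
    by (subst sum.swap) (simp add: eq sum_subtractf)
  then show ?thesis
    unfolding count r using assms(1) by (simp add: \<delta>_def sum_distrib_left)
qed

lemma sum_card_fibres:
  fixes \<phi> :: "'a \<Rightarrow> nat"
  assumes "finite X" "\<And>v. v \<in> X \<Longrightarrow> \<phi> v < r" "1 \<le> r"
  shows "card (X \<inter> \<phi> -` {0}) + (\<Sum>i = 1..<r. card (X \<inter> \<phi> -` {i})) = card X"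
proof -
  have "(\<Sum>i<r. card (X \<inter> \<phi> -` {i})) = card (\<Union>i<r. X \<inter> \<phi> -` {i})"
    using assms by (intro card_UN_disjoint[symmetric]) auto
  also have "(\<Union>i<r. X \<inter> \<phi> -` {i}) = X" using assms by auto
  finally show ?thesis
    using assms(3) by (simp add: lessThan_atLeast0 sum.atLeast_Suc_lessThan)
qed

text \<open>
  The defect of a \<open>2r\<close>-set with \<open>n\<^sub>i\<close> vertices in part \<open>i\<close> is
  \<open>2 (n\<^sub>0 choose 2) + (n\<^sub>1 choose 2) + ...\<close>. At integers, \<open>2 (n choose 2)\<close> is at least
  \<open>2n - 2\<close>, with equality at 1 and 2, and \<open>n choose 2\<close> is at least \<open>2n - 3\<close>, with equality at 2 and 3. The
  slopes agree, so the sum of the linear bounds depends on \<open>2r\<close> only; it is \<open>r + 1\<close>.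
\<close>

lemma blowup_sparse:
  assumes "finite X" "card X = 2 * r" "\<And>v. v \<in> X \<Longrightarrow> \<phi> v < r" "1 \<le> r" "1 \<le> a"
  shows "(\<Sum>e\<in>[X]\<^bsup>2\<^esup>. real (blowup a \<phi> e)) \<le>
    (real a + 1) * real (2 * r choose 2) - (real r + 1)"
proof -
  let ?n = "\<lambda>i. card (X \<inter> \<phi> -` {i})"
  have special: "2 * real n - 2 \<le> 2 * real (n choose 2)" for n
  proof -
    have "0 \<le> (real n - 1) * (real n - 2)"
    proof (cases "n \<le> 1")
      case True then show ?thesis by (intro mult_nonpos_nonpos) auto
    next
      case False then show ?thesis by (intro mult_nonneg_nonneg) auto
    qed
    then show ?thesis by (simp add: real_choose_two algebra_simps)
  qed
  have ordinary: "2 * real n - 3 \<le> real (n choose 2)" for n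
  proof -
    have "0 \<le> (real n - 2) * (real n - 3)"
    proof (cases "n \<le> 2")
      case True then show ?thesis by (intro mult_nonpos_nonpos) auto
    next
      case False then show ?thesis by (intro mult_nonneg_nonneg) auto
    qed
    then show ?thesis by (simp add: real_choose_two algebra_simps)
  qed
  have "(\<Sum>i = 1..<r. 2 * real (?n i) - 3) \<le> (\<Sum>i = 1..<r. real (?n i choose 2))"
    by (intro sum_mono ordinary)
  moreover have "(\<Sum>i = 1..<r. 2 * real (?n i) - 3) =
      2 * real (\<Sum>i = 1..<r. ?n i) - 3 * (real r - 1)"
    using assms(4) by (simp add: sum_subtractf sum_distrib_left of_nat_diff)
  moreover have "real (?n 0) + real (\<Sum>i = 1..<r. ?n i) = 2 * real r"
    unfolding of_nat_add[symmetric] using sum_card_fibres[OF assms(1,3,4)] assms(2) by simp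
  ultimately have "real r + 1 \<le> 2 * real (?n 0 choose 2) + (\<Sum>i = 1..<r. real (?n i choose 2))"
    using special[of "?n 0"] by argo
  moreover have "real (a + 1) - real (a - 1) = 2" using assms(5) by auto
  ultimately show ?thesis
    using sum_blowup[of X \<phi> r real a] assms by (simp add: algebra_simps)
qed

lemma card_residue_class_le:
  assumes "1 \<le> m" "k \<le> n"
  shows "real (card {v \<in> {k<..n}. v mod m = j}) \<le> (real n - real k) / real m + 2"
proof -
  let ?S = "{v \<in> {k<..n}. v mod m = j}"
  have "inj_on (\<lambda>v. v div m) ?S"
    by (rule inj_onI) (metis (mono_tags, lifting) mem_Collect_eq mult_div_mod_eq)
  then have "card ?S = card ((\<lambda>v. v div m) ` ?S)" by (simp add: card_image)
  also have "\<dots> \<le> card {k div m..n div m}"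
    by (intro card_mono) (auto simp: div_le_mono)
  also have "\<dots> = Suc (n div m) - k div m" by simp
  finally have "card ?S + k div m \<le> n div m + 1" using assms(2) div_le_mono[of k n m] by simp
  then have "real (card ?S) + real (k div m) \<le> real (n div m) + 1" by linarith
  moreover have "real (n div m) \<le> real n / real m"
  proof -
    have "real (n div m * m) \<le> real n" by (intro of_nat_mono) simp
    then show ?thesis using assms by (simp add: pos_le_divide_eq)
  qed
  moreover have "real k / real m \<le> real (k div m) + 1"
  proof -
    have "real k \<le> real (m + k div m * m)"
      using dividend_less_div_times[of m k] assms by (intro of_nat_mono) simp
    then show ?thesis using assms by (simp add: divide_le_eq algebra_simps)
  qed
  ultimately show ?thesis by (simp add: diff_divide_distrib)
qed

section \<open>Costs and proportions\<close>

locale multiplicity_parameters =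
  fixes a r :: nat
  assumes a_ge_2: "2 \<le> a" and r_ge_2: "2 \<le> r"
begin

text \<open>
  \<open>A\<close> and \<open>B\<close> are the costs of a pair of multiplicity \<open>a - 1\<close> and \<open>a\<close>, respectively; \<open>x\<close> and \<open>y\<close> are
  the proportions of the special part and of each other part in the optimal pattern.
\<close>

definition A :: real where "A = ln (real a + 1) - ln (real a - 1)"
definition B :: real where "B = ln (real a + 1) - ln (real a)"
definition x :: real where "x = x_star_1 a r"
definition y :: real where "y = (1 - x) / (real r - 1)"
definition rate :: real where "rate = ln (real a + 1) - y * B"
definition q :: nat where
  "q = a * (2 * r choose 2) + turan_number (2 * r) (r + 1) - 1"

lemma real_q: "real q = (real a + 1) * real (2 * r choose 2) - (real r + 1)"
proof -
  have "real (2 * r choose 2) = real r * (2 * real r - 1)"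
    by (simp add: real_choose_two)
  moreover have "real r * 3 \<le> real r * (2 * real r - 1)"
    using r_ge_2 by (intro mult_left_mono) auto
  ultimately have "real r * 3 \<le> real (2 * r choose 2)" by simp
  then have C: "r * 3 \<le> (2 * r choose 2)" by linarith
  have "q = a * (2 * r choose 2) + ((2 * r choose 2) - (r + 1))"
    unfolding q_def using C r_ge_2 turan_number_double[of r] by simp
  also have "real \<dots> = real a * real (2 * r choose 2) + (real (2 * r choose 2) - real (r + 1))"
    using C r_ge_2 by (simp add: of_nat_diff)
  finally show ?thesis by (simp add: algebra_simps)
qed

lemma B_pos: "0 < B"
  unfolding B_def using a_ge_2 by simp

lemma A_pos: "0 < A"
  unfolding A_def using a_ge_2 by simp

text \<open>
  This amounts to \<open>a\<^sup>3 < (a + 1)\<^sup>2 (a - 1)\<close>, that is \<open>a + 1 < a\<^sup>2\<close>.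
\<close>

lemma A_less: "A < 3 * B"
proof -
  have a: "real a \<ge> 2" using a_ge_2 by simp
  have "real a * real a \<ge> 2 * real a" using a by (intro mult_right_mono) auto
  then have "1 + real a < real a * real a" using a by linarith
  then have "real a ^ 3 < (real a + 1) ^ 2 * (real a - 1)"
    using a by (simp add: power2_eq_square power3_eq_cube algebra_simps)
  then have "ln (real a ^ 3) < ln ((real a + 1) ^ 2 * (real a - 1))"
    using a by (subst ln_less_cancel_iff) auto
  then show ?thesis
    using a by (simp add: A_def B_def ln_mult ln_realpow)
qed

lemma x_eq: "x = B / ((real r - 1) * A + B)"
proof -
  have "ln ((real a + 1) ^ r / ((real a - 1) ^ (r - 1) * real a)) = (real r - 1) * A + B"
    using a_ge_2 r_ge_2
    by (simp add: ln_div ln_mult ln_realpow A_def B_def of_nat_diff algebra_simps)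
  moreover have "ln ((real a + 1) / real a) = B"
    using a_ge_2 by (simp add: ln_div B_def)
  ultimately show ?thesis by (simp add: x_def x_star_1_def)
qed

lemma denominator_pos: "0 < (real r - 1) * A + B"
  using A_pos B_pos r_ge_2 by (intro add_pos_pos mult_pos_pos) auto

lemma y_eq: "y = A / ((real r - 1) * A + B)"
proof -
  have "1 - x = (real r - 1) * A / ((real r - 1) * A + B)"
    unfolding x_eq using denominator_pos by (simp add: field_simps)
  then show ?thesis unfolding y_def using r_ge_2 by simp
qed

lemma x_pos: "0 < x"
  unfolding x_eq using B_pos denominator_pos by simp

lemma y_pos: "0 < y"
  unfolding y_eq using A_pos denominator_pos by simp

lemma balance: "x * A = y * B"
  unfolding x_eq y_eq by simp

lemma weights_sum: "x + (real r - 1) * y = 1"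
  unfolding y_def using r_ge_2 by simp

lemma y_less: "y < 3 * x"
  using divide_strict_right_mono[OF A_less denominator_pos] by (simp add: x_eq y_eq)

lemma y_less_1: "y < 1"
proof -
  have "1 * y \<le> (real r - 1) * y" using r_ge_2 y_pos by (intro mult_right_mono) auto
  then show ?thesis using weights_sum x_pos by linarith
qed

lemma rate_nonneg: "0 \<le> rate"
proof -
  have "y * B \<le> 1 * B" using y_less_1 B_pos by (intro mult_right_mono) auto
  then have "ln (real a) \<le> rate" unfolding rate_def B_def by simp
  moreover have "0 \<le> ln (real a)" using a_ge_2 by simp
  ultimately show ?thesis by linarith
qed

text \<open>
  The line meeting the graph of the logarithm at \<open>a\<close> and \<open>a + 1\<close> is nowhere below it at positive
  integers: the increments \<open>ln (n + 1) - ln n\<close> decrease and \<open>B\<close> is the one at \<open>n = a\<close>.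
\<close>

lemma ln_multiplicity_le:
  assumes "1 \<le> w"
  shows "ln (real w) \<le> ln (real a + 1) - B * (real a + 1 - real w)"
proof -
  define f where "f n = ln (real n) - B * real n" for n
  have inc: "f n \<le> f (Suc n)" if "1 \<le> n" "n \<le> a" for n
  proof -
    have "(real a + 1) / real a \<le> (real n + 1) / real n"
      using that by (simp add: field_simps)
    then have "ln ((real a + 1) / real a) \<le> ln ((real n + 1) / real n)"
      using that by (subst ln_le_cancel_iff) auto
    then show ?thesis
      using that a_ge_2 by (simp add: f_def B_def ln_div algebra_simps)
  qed
  have dec: "f (Suc n) \<le> f n" if "a \<le> n" for n
  proof -
    have "(real n + 1) / real n \<le> (real a + 1) / real a"
      using that a_ge_2 by (simp add: field_simps)
    then have "ln ((real n + 1) / real n) \<le> ln ((real a + 1) / real a)"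
      using that a_ge_2 by (subst ln_le_cancel_iff) auto
    then show ?thesis
      using that a_ge_2 by (simp add: f_def B_def ln_div algebra_simps)
  qed
  have "f w \<le> f (Suc a)"
  proof (cases "w \<le> Suc a")
    case True
    then show ?thesis
    proof (induction rule: inc_induct)
      case (step n)
      then show ?case using inc[of n] assms by simp
    qed simp
  next
    case False
    then have "Suc a \<le> w" by simp
    then show ?thesis
    proof (induction rule: dec_induct)
      case (step n)
      then show ?case using dec[of n] by simp
    qed simp
  qed
  then show ?thesis by (simp add: f_def algebra_simps)
qed

end

section \<open>Upper bound: deleting vertices of low degree\<close>

lemma multiplicity_le:
  fixes w :: "'a set \<Rightarrow> nat"
  assumes "finite V" "2 \<le> s" "s \<le> card V" "e \<in> [V]\<^bsup>2\<^esup>"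
    and sparse: "\<forall>X\<in>[V]\<^bsup>s\<^esup>. (\<Sum>e\<in>[X]\<^bsup>2\<^esup>. w e) \<le> q"
  shows "w e \<le> q"
proof -
  have e: "e \<subseteq> V" "card e = 2" "finite e"
    using assms by (auto simp: nsets_def)
  then obtain X where X: "e \<subseteq> X" "X \<subseteq> V" "card X = s"
    using exists_subset_between[of e s V] assms by auto
  then have "finite X" using assms finite_subset by blast
  have "w e \<le> (\<Sum>e\<in>[X]\<^bsup>2\<^esup>. w e)"
    using X \<open>finite X\<close> e by (intro member_le_sum) (auto simp: nsets_def)
  also have "\<dots> \<le> q"
    using sparse X \<open>finite X\<close> by (auto simp: nsets_def)
  finally show ?thesis .
qed

context multiplicity_parameters
begin

text \<open>
  A graph of maximal product is positive, since the extremal pattern is. Positivity and sparsity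
  pass to subsets of the vertex set, which the deletion argument requires.
\<close>

definition positive_graph :: "'a set \<Rightarrow> ('a set \<Rightarrow> nat) \<Rightarrow> bool" where
  "positive_graph V w \<longleftrightarrow> finite V \<and> (\<forall>e\<in>[V]\<^bsup>2\<^esup>. 0 < w e) \<and>
     (\<forall>X\<in>[V]\<^bsup>(2 * r)\<^esup>. (\<Sum>e\<in>[X]\<^bsup>2\<^esup>. w e) \<le> q)"

lemma positive_graph_subset:
  assumes "positive_graph V w" "U \<subseteq> V"
  shows "positive_graph U w"
  unfolding positive_graph_def
proof (intro conjI ballI)
  show "finite U" using assms finite_subset by (auto simp: positive_graph_def)
  show "0 < w e" if "e \<in> [U]\<^bsup>2\<^esup>" for e
    using assms that nsets_mono[OF assms(2), of 2] by (auto simp: positive_graph_def)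
  show "(\<Sum>e\<in>[X]\<^bsup>2\<^esup>. w e) \<le> q" if "X \<in> [U]\<^bsup>(2 * r)\<^esup>" for X
    using assms that nsets_mono[OF assms(2), of "2 * r"] by (auto simp: positive_graph_def)
qed

lemma multiplicity_le_q:
  assumes "positive_graph V w" "2 * r \<le> card V" "e \<in> [V]\<^bsup>2\<^esup>"
  shows "w e \<le> q"
  using assms r_ge_2 multiplicity_le[of V "2 * r" e w q] by (simp add: positive_graph_def)

text \<open>
  If all degrees are larger, then for a weight \<open>p\<close> on a bounded set \<open>X\<close> the \<open>p\<close>-average of the
  degrees of \<open>X\<close> is larger too. The pairs inside \<open>X\<close> contribute only a bounded amount, which \<open>\<epsilon>\<close>
  absorbs, so some vertex outside \<open>X\<close> has \<open>p\<close>-average logarithm above \<open>rate\<close>, that is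
  \<open>p\<close>-average cost below \<open>y\<close>. This is the extension principle of \<open>dense_defect_system\<close>.
\<close>

lemma exists_low_degree_vertex:
  fixes V :: "'a set"
  assumes G: "positive_graph V w" and "2 * r \<le> card V" and "0 < \<epsilon>"
    and large: "2 * real r * ln (real q) < \<epsilon> * real (card V)"
  shows "\<exists>v\<in>V. (\<Sum>u\<in>V - {v}. ln (real (w {v, u}))) \<le> (rate + \<epsilon>) * real (card V)"
proof (rule ccontr)
  assume contra: "\<not> ?thesis"
  have fin: "finite V" using G by (simp add: positive_graph_def)
  have pos: "1 \<le> w e" if "e \<in> [V]\<^bsup>2\<^esup>" for e
    using G that by (auto simp: positive_graph_def Suc_le_eq)
  have pair: "{u, v} \<in> [V]\<^bsup>2\<^esup>" if "u \<in> V" "v \<in> V" "u \<noteq> v" for u v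
    using that by (simp add: nsets_def card_insert_if)
  define d where "d e = int a + 1 - int (w e)" for e
  define cost where "cost e = (ln (real a + 1) - ln (real (w e))) / B" for e
  have "dense_defect_system V d cost r x y"
  proof
    show "V \<noteq> {}" using assms(2) r_ge_2 by auto
    show "2 \<le> r" by (rule r_ge_2)
    show "x + (real r - 1) * y = 1" by (rule weights_sum)
    show "0 < y" "y < 3 * x" by (rule y_pos y_less)+
  next
    fix X assume X: "X \<subseteq> V" "finite X" "card X = 2 * r"
    then have "(\<Sum>e\<in>[X]\<^bsup>2\<^esup>. w e) \<le> q"
      using G by (auto simp: positive_graph_def nsets_def)
    then have "(\<Sum>e\<in>[X]\<^bsup>2\<^esup>. real (w e)) \<le> real q"
      by (metis of_nat_mono of_nat_sum)
    moreover have "real_of_int (\<Sum>e\<in>[X]\<^bsup>2\<^esup>. d e) =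
        (real a + 1) * real (2 * r choose 2) - (\<Sum>e\<in>[X]\<^bsup>2\<^esup>. real (w e))"
      using X by (simp add: d_def sum_subtractf)
    ultimately have "real_of_int (int r + 1) \<le> real_of_int (\<Sum>e\<in>[X]\<^bsup>2\<^esup>. d e)"
      using real_q by simp
    then show "int r + 1 \<le> (\<Sum>e\<in>[X]\<^bsup>2\<^esup>. d e)" by linarith
  next
    fix e assume "e \<in> [V]\<^bsup>2\<^esup>"
    then show "real_of_int (d e) \<le> cost e"
      using ln_multiplicity_le[OF pos, of e] B_pos
      by (simp add: d_def cost_def pos_le_divide_eq mult.commute)
  next
    fix e assume e: "e \<in> [V]\<^bsup>2\<^esup>" "2 \<le> d e"
    then have "w e \<le> a - 1" "1 \<le> w e" using pos[of e] a_ge_2 by (auto simp: d_def)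
    then have "ln (real (w e)) \<le> ln (real a - 1)"
      using a_ge_2 by (subst ln_le_cancel_iff) (auto simp: of_nat_diff)
    then have "x * A \<le> x * (ln (real a + 1) - ln (real (w e)))"
      using x_pos by (intro mult_left_mono) (auto simp: A_def)
    then show "y \<le> x * cost e"
      unfolding balance cost_def using B_pos by (simp add: field_simps)
  next
    fix X :: "'a set" and p :: "'a \<Rightarrow> real"
    assume X: "X \<subseteq> V" "finite X" "X \<noteq> {}" "card X \<le> 2 * r + 1"
      and p0: "\<And>v. v \<in> X \<Longrightarrow> 0 \<le> p v" and p1: "sum p X = 1"
    show "\<exists>u\<in>V - X. (\<Sum>v\<in>X. p v * cost {u, v}) < y"
    proof (rule ccontr)
      assume no: "\<not> ?thesis"
      \<comment> \<open>no extension at \<open>u\<close> means that the average logarithm is at most \<open>rate\<close>\<close>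
      have out: "(\<Sum>v\<in>X. p v * ln (real (w {v, u}))) \<le> rate" if u: "u \<in> V - X" for u
      proof -
        have "y \<le> (\<Sum>v\<in>X. p v * cost {u, v})" using no u by force
        also have "\<dots> = (\<Sum>v\<in>X. p v * ln (real a + 1) - p v * ln (real (w {v, u}))) / B"
          by (simp add: cost_def sum_divide_distrib right_diff_distrib insert_commute)
        also have "\<dots> = (ln (real a + 1) - (\<Sum>v\<in>X. p v * ln (real (w {v, u})))) / B"
          using p1 by (simp add: sum_subtractf sum_distrib_right[symmetric])
        finally show ?thesis using B_pos by (simp add: rate_def field_simps)
      qed
      \<comment> \<open>multiplicities are at most \<open>q\<close>, since each pair lies in a \<open>2r\<close>-set\<close>
      have near: "(\<Sum>u\<in>X - {v}. ln (real (w {v, u}))) \<le> 2 * real r * ln (real q)" if v: "v \<in> X" for v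
      proof -
        have le: "ln (real (w {v, u})) \<le> ln (real q)" if "u \<in> X - {v}" for u
        proof -
          have "{v, u} \<in> [V]\<^bsup>2\<^esup>" using that v X by (intro pair) auto
          then show ?thesis
            using multiplicity_le_q[OF G assms(2)] pos by (subst ln_le_cancel_iff) fastforce+
        qed
        have "0 \<le> ln (real q)"
        proof -
          have "0 < card V choose 2" using assms(2) r_ge_2 by simp
          then have "0 < card ([V]\<^bsup>2\<^esup>)" by simp
          then obtain e where "e \<in> [V]\<^bsup>2\<^esup>" by (metis card.empty ex_in_conv less_irrefl)
          then have "1 \<le> q" using multiplicity_le_q[OF G assms(2)] pos le_trans by blast
          then show ?thesis by simp
        qed
        moreover have "card (X - {v}) \<le> 2 * r" using X v by simp
        ultimately have "real (card (X - {v})) * ln (real q) \<le> real (2 * r) * ln (real q)"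
          by (intro mult_right_mono) linarith+
        moreover have "(\<Sum>u\<in>X - {v}. ln (real (w {v, u}))) \<le> real (card (X - {v})) * ln (real q)"
          by (rule sum_bounded_above) (rule le)
        ultimately show ?thesis by simp
      qed
      have deg: "(rate + \<epsilon>) * real (card V) - 2 * real r * ln (real q) \<le> (\<Sum>u\<in>V - X. ln (real (w {v, u})))"
        if v: "v \<in> X" for v
      proof -
        have "V - {v} - (X - {v}) = V - X" using v by auto
        then have "(\<Sum>u\<in>V - {v}. ln (real (w {v, u}))) =
            (\<Sum>u\<in>V - X. ln (real (w {v, u}))) + (\<Sum>u\<in>X - {v}. ln (real (w {v, u})))"
          using sum.subset_diff[of "X - {v}" "V - {v}" "\<lambda>u. ln (real (w {v, u}))"] fin X by auto
        moreover have "(rate + \<epsilon>) * real (card V) < (\<Sum>u\<in>V - {v}. ln (real (w {v, u})))"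
          using contra v X by force
        ultimately show ?thesis using near[OF v] by linarith
      qed
      have "(rate + \<epsilon>) * real (card V) - 2 * real r * ln (real q) =
          (\<Sum>v\<in>X. p v * ((rate + \<epsilon>) * real (card V) - 2 * real r * ln (real q)))"
        using p1 by (simp add: sum_distrib_right[symmetric])
      also have "\<dots> \<le> (\<Sum>v\<in>X. p v * (\<Sum>u\<in>V - X. ln (real (w {v, u}))))"
        using deg p0 by (intro sum_mono mult_left_mono)
      also have "\<dots> = (\<Sum>u\<in>V - X. \<Sum>v\<in>X. p v * ln (real (w {v, u})))"
        unfolding sum_distrib_left by (rule sum.swap)
      also have "\<dots> \<le> real (card (V - X)) * rate"
        by (rule sum_bounded_above) (rule out)
      also have "\<dots> \<le> real (card V) * rate"
        using rate_nonneg fin by (intro mult_right_mono of_nat_mono card_mono) auto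
      finally show False using large by (simp add: algebra_simps)
    qed
  qed
  then show False by (rule dense_defect_system.inconsistent)
qed

lemma ln_product_le:
  fixes V :: "'a set"
  assumes "0 < \<epsilon>"
  obtains N K where "2 * r \<le> N"
    "\<And>(V :: 'a set) w. positive_graph V w \<Longrightarrow> N \<le> card V \<Longrightarrow>
      (\<Sum>e\<in>[V]\<^bsup>2\<^esup>. ln (real (w e))) \<le> (rate + \<epsilon>) * (real (card V) * (real (card V) + 1) / 2) + K"
proof -
  define N where "N = max (2 * r) (nat \<lceil>2 * real r * ln (real q) / \<epsilon>\<rceil> + 1)"
  define K where "K = real (N choose 2) * ln (real q)"
  have N: "2 * real r * ln (real q) < \<epsilon> * real n" if "N \<le> n" for n
  proof -
    have "2 * real r * ln (real q) / \<epsilon> < real n" using that unfolding N_def by linarith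
    then show ?thesis using assms by (simp add: field_simps)
  qed
  have "(\<Sum>e\<in>[V]\<^bsup>2\<^esup>. ln (real (w e))) \<le> (rate + \<epsilon>) * (real n * (real n + 1) / 2) + K"
    if "N \<le> n" "positive_graph V w" "card V = n" for n and V :: "'a set" and w
    using that
  proof (induction n arbitrary: V rule: dec_induct)
    case base
    have "ln (real (w e)) \<le> ln (real q)" if e: "e \<in> [V]\<^bsup>2\<^esup>" for e
    proof -
      have "w e \<le> q" "0 < w e"
        using e base multiplicity_le_q[of V w e] by (auto simp: N_def positive_graph_def)
      then show ?thesis by (subst ln_le_cancel_iff) auto
    qed
    then have "(\<Sum>e\<in>[V]\<^bsup>2\<^esup>. ln (real (w e))) \<le> real (card ([V]\<^bsup>2\<^esup>)) * ln (real q)"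
      by (rule sum_bounded_above)
    moreover have "0 \<le> (rate + \<epsilon>) * (real N * (real N + 1) / 2)"
      using rate_nonneg assms by simp
    ultimately show ?case using base by (simp add: K_def)
  next
    case (step n)
    have fin: "finite V" using step by (simp add: positive_graph_def)
    have NV: "N \<le> card V" using step by simp
    obtain v where v: "v \<in> V"
      "(\<Sum>u\<in>V - {v}. ln (real (w {v, u}))) \<le> (rate + \<epsilon>) * real (card V)"
      using exists_low_degree_vertex[OF step.prems(1) _ assms N[OF NV]] NV by (auto simp: N_def)
    have "(\<Sum>e\<in>[V]\<^bsup>2\<^esup>. ln (real (w e))) =
        (\<Sum>e\<in>[V - {v}]\<^bsup>2\<^esup>. ln (real (w e))) + (\<Sum>u\<in>V - {v}. ln (real (w {v, u})))"
      using sum_nsets_2_insert[of "V - {v}" v "\<lambda>e. ln (real (w e))"] fin v by (simp add: insert_absorb)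
    also have "\<dots> \<le> (rate + \<epsilon>) * (real n * (real n + 1) / 2) + K + (rate + \<epsilon>) * real (card V)"
    proof (intro add_mono v(2))
      have "positive_graph (V - {v}) w" by (rule positive_graph_subset[OF step.prems(1)]) auto
      moreover have "card (V - {v}) = n" using v(1) step.prems by simp
      ultimately show "(\<Sum>e\<in>[V - {v}]\<^bsup>2\<^esup>. ln (real (w e)))
          \<le> (rate + \<epsilon>) * (real n * (real n + 1) / 2) + K"
        by (rule step.IH)
    qed
    also have "\<dots> = (rate + \<epsilon>) * (real (Suc n) * (real (Suc n) + 1) / 2) + K"
      using step by (simp add: field_simps)
    finally show ?case .
  qed
  then show thesis using that[of N K] unfolding N_def by auto
qed

end

section \<open>Lower bound: the pattern with optimal proportions\<close>

lemma finite_sq_graphs: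
  assumes "2 \<le> s" "s \<le> n"
  shows "finite (sq_graphs n s q)"
proof (rule finite_subset)
  show "sq_graphs n s q \<subseteq> [{1..n}]\<^bsup>2\<^esup> \<rightarrow>\<^sub>E {..q}"
  proof
    fix w assume "w \<in> sq_graphs n s q"
    then have w: "w \<in> [{1..n}]\<^bsup>2\<^esup> \<rightarrow>\<^sub>E UNIV"
      "\<forall>X\<in>[{1..n}]\<^bsup>s\<^esup>. (\<Sum>e\<in>[X]\<^bsup>2\<^esup>. w e) \<le> q"
      by (auto simp: sq_graphs_def sq_graph_def multigraph_def)
    have "w e \<le> q" if "e \<in> [{1..n}]\<^bsup>2\<^esup>" for e
      using multiplicity_le[of "{1..n}" s e w q] that w assms by simp
    then show "w \<in> [{1..n}]\<^bsup>2\<^esup> \<rightarrow>\<^sub>E {..q}" using w(1) by (auto simp: PiE_iff)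
  qed
  show "finite ([{1..n}]\<^bsup>2\<^esup> \<rightarrow>\<^sub>E {..q})" by (intro finite_PiE) auto
qed

lemma edge_product_le_ex_prod_fin:
  assumes "2 \<le> s" "s \<le> n" "w \<in> sq_graphs n s q"
  shows "edge_product {1..n} w \<le> ex_prod_fin n s q"
  unfolding ex_prod_fin_def using assms finite_sq_graphs by (intro Max_ge) auto

lemma ex_prod_fin_attained:
  assumes "2 \<le> s" "s \<le> n"
  obtains w where "w \<in> sq_graphs n s q" "edge_product {1..n} w = ex_prod_fin n s q"
proof -
  have "(\<lambda>e\<in>[{1..n}]\<^bsup>2\<^esup>. 0) \<in> sq_graphs n s q"
  proof -
    have "(\<Sum>e\<in>[X]\<^bsup>2\<^esup>. (\<lambda>e\<in>[{1..n}]\<^bsup>2\<^esup>. 0 :: nat) e) = 0" if "X \<in> [{1..n}]\<^bsup>s\<^esup>" for X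
      using that nsets_mono[of X "{1..n}" 2] by (intro sum.neutral ballI) (auto simp: nsets_def)
    then show ?thesis by (simp add: sq_graphs_def sq_graph_def multigraph_def)
  qed
  then have "ex_prod_fin n s q \<in> edge_product {1..n} ` sq_graphs n s q"
    unfolding ex_prod_fin_def using finite_sq_graphs[OF assms] by (intro Max_in) auto
  then show thesis using that by auto
qed

context multiplicity_parameters
begin

text \<open>
  The first \<open>x n\<close> vertices form the special part; the residue classes modulo \<open>r - 1\<close> split the
  others evenly.
\<close>

definition part :: "nat \<Rightarrow> nat \<Rightarrow> nat" where
  "part n v = (if real v \<le> x * real n then 0 else 1 + v mod (r - 1))"

lemma part_less: "part n v < r"
proof -
  have "v mod (r - 1) < r - 1" using r_ge_2 by (intro mod_less_divisor) auto
  then have "1 + v mod (r - 1) < r" by linarith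
  then show ?thesis using r_ge_2 unfolding part_def by simp
qed

lemma x_less_1: "x < 1"
proof -
  have "0 < (real r - 1) * y" using r_ge_2 y_pos by (intro mult_pos_pos) auto
  then show ?thesis using weights_sum by linarith
qed

lemma blowup_in_sq_graphs:
  "restrict (blowup a (part n)) ([{1..n}]\<^bsup>2\<^esup>) \<in> sq_graphs n (2 * r) q"
proof -
  have "(\<Sum>e\<in>[X]\<^bsup>2\<^esup>. restrict (blowup a (part n)) ([{1..n}]\<^bsup>2\<^esup>) e) \<le> q"
    if X: "X \<in> [{1..n}]\<^bsup>(2 * r)\<^esup>" for X
  proof -
    have X': "finite X" "card X = 2 * r" "X \<subseteq> {1..n}" using X by (auto simp: nsets_def)
    have "(\<Sum>e\<in>[X]\<^bsup>2\<^esup>. restrict (blowup a (part n)) ([{1..n}]\<^bsup>2\<^esup>) e) =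
        (\<Sum>e\<in>[X]\<^bsup>2\<^esup>. blowup a (part n) e)"
      using nsets_mono[OF X'(3), of 2] by (intro sum.cong) auto
    moreover have "real (\<Sum>e\<in>[X]\<^bsup>2\<^esup>. blowup a (part n) e) \<le> real q"
      unfolding of_nat_sum real_q
      using X' part_less a_ge_2 r_ge_2 by (intro blowup_sparse) auto
    ultimately show ?thesis by linarith
  qed
  then show ?thesis by (simp add: sq_graphs_def sq_graph_def multigraph_def)
qed

lemma card_special_part: "real (card ({1..n} \<inter> part n -` {0})) \<le> x * real n"
proof -
  have "{1..n} \<inter> part n -` {0} \<subseteq> {1..nat \<lfloor>x * real n\<rfloor>}"
    by (auto simp: part_def le_nat_floor split: if_splits)
  then have "card ({1..n} \<inter> part n -` {0}) \<le> nat \<lfloor>x * real n\<rfloor>"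
    using card_mono[of "{1..nat \<lfloor>x * real n\<rfloor>}"] by fastforce
  then have "real (card ({1..n} \<inter> part n -` {0})) \<le> real (nat \<lfloor>x * real n\<rfloor>)" by simp
  also have "\<dots> \<le> x * real n" using x_pos by (intro of_nat_floor) simp
  finally show ?thesis .
qed

lemma card_ordinary_part:
  assumes "1 \<le> i"
  shows "real (card ({1..n} \<inter> part n -` {i})) \<le> y * real n + 3"
proof -
  define k where "k = nat \<lfloor>x * real n\<rfloor>"
  have "x * real n \<le> real n" using x_less_1 by (simp add: mult_left_le_one_le x_pos less_imp_le)
  then have k: "k \<le> n" "x * real n < real k + 1"
    using x_pos unfolding k_def by linarith+
  have "{1..n} \<inter> part n -` {i} \<subseteq> {v \<in> {k<..n}. v mod (r - 1) = i - 1}"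
  proof
    fix v assume "v \<in> {1..n} \<inter> part n -` {i}"
    then have "\<not> real v \<le> x * real n" "v \<le> n" "v mod (r - 1) = i - 1"
      using assms by (auto simp: part_def split: if_splits)
    moreover have "real k \<le> x * real n" unfolding k_def using x_pos by (intro of_nat_floor) simp
    ultimately show "v \<in> {v \<in> {k<..n}. v mod (r - 1) = i - 1}" by auto
  qed
  then have "real (card ({1..n} \<inter> part n -` {i})) \<le> real (card {v \<in> {k<..n}. v mod (r - 1) = i - 1})"
    by (intro of_nat_mono card_mono) auto
  also have "\<dots> \<le> (real n - real k) / real (r - 1) + 2"
    using r_ge_2 k by (intro card_residue_class_le) auto
  also have "\<dots> \<le> ((real r - 1) * y * real n + 1) / real (r - 1) + 2"
  proof -
    have "x * real n + (real r - 1) * y * real n = real n"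
      using weights_sum by (metis distrib_right mult_1)
    then have "real n - real k \<le> (real r - 1) * y * real n + 1" using k by linarith
    then show ?thesis by (intro add_right_mono divide_right_mono) auto
  qed
  also have "\<dots> = y * real n + 1 / (real r - 1) + 2"
    using r_ge_2 by (simp add: add_divide_distrib of_nat_diff)
  also have "\<dots> \<le> y * real n + 3"
    using r_ge_2 by simp
  finally show ?thesis .
qed

lemma ln_ex_prod_fin_ge:
  assumes "2 * r \<le> n"
  shows "0 < ex_prod_fin n (2 * r) q"
    and "real (n choose 2) * ln (real a + 1) - (A * (x * real n)\<^sup>2 + B * (real r - 1) * (y * real n + 3)\<^sup>2) / 2
      \<le> ln (real (ex_prod_fin n (2 * r) q))"
proof -
  let ?V = "{1..n}" and ?w = "blowup a (part n)"
  have pos: "0 < ?w e" for e using a_ge_2 by (simp add: blowup_def)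
  have prod: "edge_product ?V (restrict ?w ([?V]\<^bsup>2\<^esup>)) = (\<Prod>e\<in>[?V]\<^bsup>2\<^esup>. ?w e)"
    unfolding edge_product_def by (intro prod.cong) auto
  have le: "(\<Prod>e\<in>[?V]\<^bsup>2\<^esup>. ?w e) \<le> ex_prod_fin n (2 * r) q"
    using edge_product_le_ex_prod_fin[OF _ assms blowup_in_sq_graphs] prod r_ge_2 by simp
  have pos': "0 < (\<Prod>e\<in>[?V]\<^bsup>2\<^esup>. ?w e)" using pos by (intro prod_pos) auto
  then show "0 < ex_prod_fin n (2 * r) q" using le by linarith
  have "ln (real (\<Prod>e\<in>[?V]\<^bsup>2\<^esup>. ?w e)) = (\<Sum>e\<in>[?V]\<^bsup>2\<^esup>. ln (real (?w e)))"
    unfolding of_nat_prod using pos by (intro ln_prod) auto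
  also have "\<dots> = real (n choose 2) * ln (real a + 1)
      - A * real (card (?V \<inter> part n -` {0}) choose 2)
      - B * (\<Sum>i = 1..<r. real (card (?V \<inter> part n -` {i}) choose 2))"
    using sum_blowup[of ?V "part n" r "\<lambda>m. ln (real m)" a] part_less a_ge_2 r_ge_2
    by (simp add: A_def B_def of_nat_diff add.commute)
  also have "\<dots> \<ge> real (n choose 2) * ln (real a + 1)
      - A * ((x * real n)\<^sup>2 / 2) - B * ((real r - 1) * ((y * real n + 3)\<^sup>2 / 2))"
  proof -
    have "real (card (?V \<inter> part n -` {0}) choose 2) \<le> (x * real n)\<^sup>2 / 2"
      using choose_two_le[of "card (?V \<inter> part n -` {0})"]
        power_mono[OF card_special_part[of n], of 2] by simp
    then have 1: "A * real (card (?V \<inter> part n -` {0}) choose 2) \<le> A * ((x * real n)\<^sup>2 / 2)"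
      using A_pos by (intro mult_left_mono) auto
    have "real (card (?V \<inter> part n -` {i}) choose 2) \<le> (y * real n + 3)\<^sup>2 / 2" if "i \<in> {1..<r}" for i
      using choose_two_le[of "card (?V \<inter> part n -` {i})"]
        power_mono[OF card_ordinary_part[of i n], of 2] that by simp
    then have "(\<Sum>i = 1..<r. real (card (?V \<inter> part n -` {i}) choose 2))
        \<le> real (card {1..<r}) * ((y * real n + 3)\<^sup>2 / 2)"
      by (rule sum_bounded_above)
    then have 2: "B * (\<Sum>i = 1..<r. real (card (?V \<inter> part n -` {i}) choose 2))
        \<le> B * ((real r - 1) * ((y * real n + 3)\<^sup>2 / 2))"
      using B_pos r_ge_2 by (intro mult_left_mono) (auto simp: of_nat_diff)
    show ?thesis using 1 2 by linarith
  qed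
  finally have "real (n choose 2) * ln (real a + 1)
      - A * ((x * real n)\<^sup>2 / 2) - B * ((real r - 1) * ((y * real n + 3)\<^sup>2 / 2))
      \<le> ln (real (\<Prod>e\<in>[?V]\<^bsup>2\<^esup>. ?w e))" .
  also have "\<dots> \<le> ln (real (ex_prod_fin n (2 * r) q))"
    using le pos' \<open>0 < ex_prod_fin n (2 * r) q\<close> by (subst ln_le_cancel_iff) (simp_all del: of_nat_prod)
  finally show "real (n choose 2) * ln (real a + 1) - (A * (x * real n)\<^sup>2 + B * (real r - 1) * (y * real n + 3)\<^sup>2) / 2
      \<le> ln (real (ex_prod_fin n (2 * r) q))"
    by (simp add: field_simps)
qed

section \<open>The limit\<close>

text \<open>
  The cost of the pattern is a quadratic form in the proportions; the balance \<open>x A = y B\<close> turns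
  its value at the optimum into \<open>y B\<close>.
\<close>

lemma rate_eq_lower: "rate = ln (real a + 1) - (A * x\<^sup>2 + B * (real r - 1) * y\<^sup>2)"
proof -
  have "A * x\<^sup>2 + B * (real r - 1) * y\<^sup>2 = (x * A) * x + (y * B) * ((real r - 1) * y)"
    by (simp add: power2_eq_square)
  also have "\<dots> = (y * B) * (x + (real r - 1) * y)"
    unfolding balance by (simp add: algebra_simps)
  finally show ?thesis unfolding rate_def weights_sum by simp
qed

lemma ex_prod_seq_tendsto: "ex_prod_seq (2 * r) q \<longlonglongrightarrow> exp rate"
proof (rule order_tendstoI)
  have large: "eventually (\<lambda>n. 2 * r \<le> n) sequentially" by (rule eventually_ge_at_top)
  have choose_pos: "0 < n choose 2" if "2 * r \<le> n" for n using that r_ge_2 by simp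
  have seq: "ex_prod_seq (2 * r) q n = exp (ln (real (ex_prod_fin n (2 * r) q)) / real (n choose 2))"
    if "2 * r \<le> n" for n
    using root_exp[OF choose_pos[OF that]] ln_ex_prod_fin_ge(1)[OF that]
    by (metis ex_prod_seq_def exp_ln of_nat_0_less_iff)
  {
    fix c assume c: "c < exp rate"
    define l where "l n = ln (real a + 1) -
      (A * (x * real n)\<^sup>2 + B * (real r - 1) * (y * real n + 3)\<^sup>2) / (real n * (real n - 1))" for n
    have "l \<longlonglongrightarrow> ln (real a + 1) - (A * x\<^sup>2 + B * (real r - 1) * y\<^sup>2)"
    proof -
      have "l n = ln (real a + 1) -
          ((A * x\<^sup>2 + B * (real r - 1) * y\<^sup>2) * ((real n)\<^sup>2 / (real n * (real n - 1)))
           + 6 * B * (real r - 1) * y * (real n / (real n * (real n - 1)))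
           + 9 * B * (real r - 1) * (1 / (real n * (real n - 1))))" for n
      proof -
        have "A * (x * real n)\<^sup>2 + B * (real r - 1) * (y * real n + 3)\<^sup>2 =
            (A * x\<^sup>2 + B * (real r - 1) * y\<^sup>2) * (real n)\<^sup>2
            + 6 * B * (real r - 1) * y * real n + 9 * B * (real r - 1)"
          by (simp add: power2_eq_square algebra_simps)
        then show ?thesis
          unfolding l_def by (simp only: add_divide_distrib times_divide_eq_right mult_1_right)
      qed
      then have l_eq: "l = (\<lambda>n. ln (real a + 1) -
          ((A * x\<^sup>2 + B * (real r - 1) * y\<^sup>2) * ((real n)\<^sup>2 / (real n * (real n - 1)))
           + 6 * B * (real r - 1) * y * (real n / (real n * (real n - 1)))
           + 9 * B * (real r - 1) * (1 / (real n * (real n - 1)))))"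
        by (rule ext)
      have lims: "(\<lambda>n. (real n)\<^sup>2 / (real n * (real n - 1))) \<longlonglongrightarrow> 1"
        "(\<lambda>n. real n / (real n * (real n - 1))) \<longlonglongrightarrow> 0"
        "(\<lambda>n. 1 / (real n * (real n - 1))) \<longlonglongrightarrow> 0"
        by real_asymp+
      show ?thesis
        unfolding l_eq by (rule tendsto_eq_rhs, (rule tendsto_intros lims)+) simp
    qed
    then have "(\<lambda>n. exp (l n)) \<longlonglongrightarrow> exp rate"
      unfolding rate_eq_lower by (rule tendsto_exp)
    then have "eventually (\<lambda>n. c < exp (l n)) sequentially" using c by (rule order_tendstoD)
    with large show "eventually (\<lambda>n. c < ex_prod_seq (2 * r) q n) sequentially"
    proof eventually_elim
      case (elim n)
      have "l n \<le> ln (real (ex_prod_fin n (2 * r) q)) / real (n choose 2)"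
      proof -
        have "l n = (real (n choose 2) * ln (real a + 1) -
            (A * (x * real n)\<^sup>2 + B * (real r - 1) * (y * real n + 3)\<^sup>2) / 2) / real (n choose 2)"
          using choose_pos[OF elim(1)] by (simp add: l_def diff_divide_distrib) (simp add: real_choose_two)
        also have "\<dots> \<le> ln (real (ex_prod_fin n (2 * r) q)) / real (n choose 2)"
          using ln_ex_prod_fin_ge(2)[OF elim(1)] by (intro divide_right_mono) auto
        finally show ?thesis .
      qed
      then have "exp (l n) \<le> ex_prod_seq (2 * r) q n" unfolding seq[OF elim(1)] by simp
      with elim(2) show ?case by (rule less_le_trans)
    qed
  }
  {
    fix c assume c: "exp rate < c"
    \<comment> \<open>the bound \<open>u\<close> below tends to \<open>rate + \<epsilon>\<close>, which has to stay below \<open>ln c\<close>\<close>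
    define \<epsilon> where "\<epsilon> = (ln c - rate) / 2"
    have "0 < c" using c exp_gt_zero less_trans by blast
    then have "rate < ln c" using c by (metis ln_exp ln_less_cancel_iff exp_gt_zero)
    then have \<epsilon>: "0 < \<epsilon>" "rate + \<epsilon> < ln c" by (auto simp: \<epsilon>_def field_simps)
    obtain N K where N: "2 * r \<le> N"
      "\<And>(V :: nat set) w. positive_graph V w \<Longrightarrow> N \<le> card V \<Longrightarrow>
        (\<Sum>e\<in>[V]\<^bsup>2\<^esup>. ln (real (w e))) \<le> (rate + \<epsilon>) * (real (card V) * (real (card V) + 1) / 2) + K"
      using ln_product_le[OF \<epsilon>(1)] by metis
    define u where "u n = ((rate + \<epsilon>) * (real n * (real n + 1)) + 2 * K) / (real n * (real n - 1))" for n
    have "u \<longlonglongrightarrow> rate + \<epsilon>"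
      unfolding u_def by real_asymp
    then have "eventually (\<lambda>n. u n < ln c) sequentially" using \<epsilon>(2) by (rule order_tendstoD)
    with eventually_ge_at_top[of N] show "eventually (\<lambda>n. ex_prod_seq (2 * r) q n < c) sequentially"
    proof eventually_elim
      case (elim n)
      then have n: "2 * r \<le> n" using N by simp
      let ?V = "{1..n}"
      obtain w where w: "w \<in> sq_graphs n (2 * r) q" "edge_product ?V w = ex_prod_fin n (2 * r) q"
        using ex_prod_fin_attained[of "2 * r" n] n r_ge_2 by auto
      have pos: "0 < w e" if "e \<in> [?V]\<^bsup>2\<^esup>" for e
        using ln_ex_prod_fin_ge(1)[OF n] that unfolding w(2)[symmetric] edge_product_def
        by (metis finite_atLeastAtMost finite_nsets_2 gr0I less_irrefl prod_zero_iff)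
      have "positive_graph ?V w"
        using w(1) pos by (auto simp: positive_graph_def sq_graphs_def sq_graph_def)
      then have "(\<Sum>e\<in>[?V]\<^bsup>2\<^esup>. ln (real (w e))) \<le> (rate + \<epsilon>) * (real n * (real n + 1) / 2) + K"
        using N(2)[of ?V w] elim by simp
      moreover have "ln (real (ex_prod_fin n (2 * r) q)) = (\<Sum>e\<in>[?V]\<^bsup>2\<^esup>. ln (real (w e)))"
        unfolding w(2)[symmetric] edge_product_def of_nat_prod
        using pos by (intro ln_prod) fastforce+
      ultimately have "ln (real (ex_prod_fin n (2 * r) q)) / real (n choose 2)
          \<le> ((rate + \<epsilon>) * (real n * (real n + 1) / 2) + K) / real (n choose 2)"
        by (intro divide_right_mono) auto
      also have "\<dots> = u n"
        using choose_pos[OF n] unfolding u_def real_choose_two by (simp add: field_simps)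
      finally have "exp (ln (real (ex_prod_fin n (2 * r) q)) / real (n choose 2)) < exp (ln c)"
        using elim(2) by simp
      then show ?case using seq[OF n] \<open>0 < c\<close> by simp
    qed
  }
qed

lemma exp_rate:
  "exp rate = real a powr ((1 - x) / (real r - 1)) * (real a + 1) powr ((real r - 2 + x) / (real r - 1))"
proof -
  have "(real r - 2 + x) / (real r - 1) = 1 - y"
    using r_ge_2 by (simp add: y_def field_simps)
  moreover have "rate = y * ln (real a) + (1 - y) * ln (real a + 1)"
    by (simp add: rate_def B_def algebra_simps)
  ultimately show ?thesis
    using a_ge_2 by (simp add: powr_def exp_add y_def[symmetric])
qed

end

theorem theorem1p6:
  fixes a r :: nat
  assumes "a \<ge> 2" and "r \<ge> 2"
  shows "convergent (ex_prod_seq (2 * r) (a * ((2 * r) choose 2) + turan_number (2 * r) (r + 1) - 1)) \<and>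
    ex_prod (2 * r) (a * ((2 * r) choose 2) + turan_number (2 * r) (r + 1) - 1) =
      real a powr ((1 - x_star_1 a r) / (real r - 1)) *
      (real a + 1) powr ((real r - 2 + x_star_1 a r) / (real r - 1))"
proof -
  interpret multiplicity_parameters a r using assms by unfold_locales
  have "ex_prod_seq (2 * r) q \<longlonglongrightarrow> exp rate" by (rule ex_prod_seq_tendsto)
  then show ?thesis
    unfolding ex_prod_def exp_rate x_def q_def
    by (auto simp: convergent_def dest: limI)
qed

end
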